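(* For all fixed integers $d,t\ge 1$ there is a constant $c=c(d,t)>0$ such that for every fixed integer $p\ge 3$, $$f_{d,t}(n,p,\lceil\log p\rceil+1)\ \ge\ \Omega\left(n^{\frac{1}{c\log^2 p}}\right)\qquad (n\to\infty).$$ Moreover, for $t\ge 4$, $$f_{d,t}(n,p,\lceil\log p\rceil)\ \le\ O(\log n)\qquad (n\to\infty).$$ The constants implied by $\Omega$ and $O$ may depend on the fixed parameters $d,t,p$ but not on $n$.
   Context: Logarithms are to base $2$. Semi-algebraic relations. Let $V$ be a finite set of points in $\mathbb{R}^d$ and let $E\subset\binom{V}{2}$. Then $E$ is a (symmetric) semi-algebraic relation on $V$ of complexity at most $t$ if there are polynomials $g_1,\dots,g_s\in\mathbb{R}[x_1,\dots,x_{2d}]$ with $s\le t$, each of degree at most $t$, and a Boolean formula $\Phi$ such that for all distinct $u,v\in V$, $$uv\in E\iff \Phi\big(g_1(u,v)\ge 0;\dots;g_s(u,v)\ge 0\big)=1,$$ where $uv=\{u,v\}$, and in $g_\ell(u,v)$ the variables $x_1,\dots,x_d$ are replaced by the coordinates of $u$ and $x_{d+1},\dots,x_{2d}$ by the coordinates of $v$. The relation defined by $\Phi$ and the $g_\ell$ is assumed to be symmetric: for all $u,v\in\mathbb{R}^d$, the right-hand side holds for $(u,v)$ if and only if it holds for $(v,u)$. For integers $p\ge 3$ and $2\le q\le\binom p2$, a $(p,q)$-coloring is an edge-coloring of a complete graph in which every $p$ vertices induce at least $q$ distinct colors. $f_{d,t}(n,p,q)$ is the minimum $m$ such that there is a $(p,q)$-coloring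 with $m$ colors of the complete graph on some $n$-element point set $V\subset\mathbb{R}^d$ in which every edge receives exactly one color and each color class is a semi-algebraic relation on $V$ of complexity at most $t$; that is, $\binom V2$ is partitioned into pairwise disjoint semi-algebraic relations $E_1,\dots,E_m$ of complexity at most $t$ such that for every $S\subset V$ with $|S|=p$, at least $q$ of the $E_k$ meet $\binom S2$. If no such coloring exists for any $m$, then $f_{d,t}(n,p,q)=\infty$. *)

theory Defs
  imports
    "HOL-Analysis.Analysis"
    "HOL-Library.Poly_Mapping"
    "HOL-Library.Ramsey"
    "HOL-Library.Extended_Nat"
    "HOL-Library.Extended_Real"
begin

(* Multivariate polynomials are finitely supported maps from monomials (exponent vectors) to
   coefficients. *)
type_synonym ('x, 'a) mvpoly = "('x \<Rightarrow>\<^sub>0 nat) \<Rightarrow>\<^sub>0 'a"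

definition mvpoly_eval :: "('x, 'a::comm_semiring_1) mvpoly \<Rightarrow> ('x \<Rightarrow> 'a) \<Rightarrow> 'a" where
  "mvpoly_eval g a =
     (\<Sum>mo \<in> Poly_Mapping.keys g.
        Poly_Mapping.lookup g mo *
        (\<Prod>x \<in> Poly_Mapping.keys mo. a x ^ Poly_Mapping.lookup mo x))"

(* The zero polynomial gets total degree 0. *)
definition mvpoly_degree :: "('x, 'a::zero) mvpoly \<Rightarrow> nat" where
  "mvpoly_degree g =
     Max (insert 0
       ((\<lambda>mo. \<Sum>x \<in> Poly_Mapping.keys mo. Poly_Mapping.lookup mo x) ` Poly_Mapping.keys g))"

datatype 'v bool_formula =
    BConst bool
  | BVar 'v
  | BNot "'v bool_formula"
  | BAnd "'v bool_formula" "'v bool_formula"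
  | BOr "'v bool_formula" "'v bool_formula"

primrec bool_formula_eval :: "('v \<Rightarrow> bool) \<Rightarrow> 'v bool_formula \<Rightarrow> bool" where
  "bool_formula_eval \<alpha> (BConst b) = b"
| "bool_formula_eval \<alpha> (BVar i) = \<alpha> i"
| "bool_formula_eval \<alpha> (BNot \<phi>) = (\<not> bool_formula_eval \<alpha> \<phi>)"
| "bool_formula_eval \<alpha> (BAnd \<phi> \<psi>) = (bool_formula_eval \<alpha> \<phi> \<and> bool_formula_eval \<alpha> \<psi>)"
| "bool_formula_eval \<alpha> (BOr \<phi> \<psi>) = (bool_formula_eval \<alpha> \<phi> \<or> bool_formula_eval \<alpha> \<psi>)"

(* The 2d variables are indexed by the sum type 'd + 'd with d = CARD('d): the variable Inl i
   stands for the i-th coordinate of u, the variable Inr i for the i-th coordinate of v. *)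
definition semialg_holds ::
  "nat bool_formula \<Rightarrow> ('d + 'd, real) mvpoly list \<Rightarrow> real ^ 'd \<Rightarrow> real ^ 'd \<Rightarrow> bool" where
  "semialg_holds \<Phi> gs u v \<longleftrightarrow>
     bool_formula_eval (\<lambda>l. mvpoly_eval (gs ! l) (case_sum (($) u) (($) v)) \<ge> 0) \<Phi>"

definition semialg_relation ::
  "(real ^ 'd) set \<Rightarrow> nat \<Rightarrow> (real ^ 'd) set set \<Rightarrow> bool" where
  "semialg_relation V t E \<longleftrightarrow>
     E \<subseteq> [V]\<^bsup>2\<^esup> \<and>
     (\<exists>(gs :: ('d + 'd, real) mvpoly list) \<Phi>.
        length gs \<le> t \<and>
        (\<forall>g \<in> set gs. mvpoly_degree g \<le> t) \<and>
        set_bool_formula \<Phi> \<subseteq> {..<length gs} \<and>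
        (\<forall>u v. semialg_holds \<Phi> gs u v \<longleftrightarrow> semialg_holds \<Phi> gs v u) \<and>
        (\<forall>u \<in> V. \<forall>v \<in> V. u \<noteq> v \<longrightarrow> ({u, v} \<in> E \<longleftrightarrow> semialg_holds \<Phi> gs u v)))"

(* Colour classes are allowed to be empty; this does not affect the minimum below, since
   empty classes can be dropped. *)
definition pq_coloring ::
  "'a set \<Rightarrow> nat \<Rightarrow> nat \<Rightarrow> nat \<Rightarrow> (nat \<Rightarrow> 'a set set) \<Rightarrow> bool" where
  "pq_coloring V p q m E \<longleftrightarrow>
     (\<Union>k<m. E k) = [V]\<^bsup>2\<^esup> \<and>
     disjoint_family_on E {..<m} \<and>
     (\<forall>S \<in> [V]\<^bsup>p\<^esup>. q \<le> card {k \<in> {..<m}. E k \<inter> [S]\<^bsup>2\<^esup> \<noteq> {}})"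

(* The dimension d is CARD('d). The infimum of the empty set in enat is infinity. *)
definition semialg_ramsey :: "'d::finite itself \<Rightarrow> nat \<Rightarrow> nat \<Rightarrow> nat \<Rightarrow> nat \<Rightarrow> enat" where
  "semialg_ramsey _ t n p q =
     Inf {enat m | m. \<exists>(V :: (real ^ 'd) set) E.
            finite V \<and> card V = n \<and> pq_coloring V p q m E \<and>
            (\<forall>k<m. semialg_relation V t (E k))}"

end

theory Submission
  imports Defs "HOL-Real_Asymp.Real_Asymp"
begin

text \<open>
  Lower bound. After linearization (monomials in the coordinates of \<open>u\<close>), the color of \<open>uv\<close> is
  determined by the signs at \<open>u\<close> of at most \<open>m t\<close> linear functionals attached to \<open>v\<close>, in a
  dimension \<open>D\<close> depending only on \<open>d\<close> and \<open>t\<close>. Let \<open>R = \<lceil>log p\<rceil>\<close> and \<open>k = m\<^sup>R + 1\<close>. A cutting lemma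
  yields large cells on which all but a fraction \<open>1 / (4 k)\<close> of the \<open>v\<close> have a constant color, and
  hence \<open>k\<close> parts such that any two of them are joined in a single color; up to logarithms, the
  parts are smaller than the whole only by a factor polynomial in \<open>k m\<close> of degree \<open>O(D)\<close>. Recursing
  inside the parts, the pigeonhole principle gives two parts containing \<open>2\<^sup>r\<close> points each which use
  the same \<open>r\<close> colors, so their union is a set of \<open>2\<^sup>r\<^sup>+\<^sup>1\<close> points with \<open>r + 1\<close> colors. After \<open>R\<close>
  rounds this produces \<open>p\<close> points with at most \<open>R\<close> colors unless \<open>n\<close> is at most \<open>m\<close> to the power
  \<open>O(D R\<^sup>2)\<close>.

  Upper bound. Take the integers whose ternary digits are 0 or 1 and color a pair by the position of
  the highest differing digit, which can be read off from the distance. Points that use only \<open>q\<close>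
  colors are distinguished by \<open>q\<close> binary digits.
\<close>

subsection \<open>Cutting lemma\<close>

definition lin :: "(nat \<Rightarrow> 'x \<Rightarrow> real) \<Rightarrow> nat \<Rightarrow> (nat \<Rightarrow> real) \<Rightarrow> 'x \<Rightarrow> real" where
  "lin \<phi> n a x = (\<Sum>i<n. a i * \<phi> i x)"

text \<open>Fourier-Motzkin elimination of the last coordinate. A functional with
  \<open>a n \<noteq> 0\<close> vanishes where \<open>\<phi> n x\<close> equals the threshold
  \<open>- lin \<phi> n a x / a n\<close>. The new functionals are differences of two thresholds and
  compare them without reference to \<open>\<phi> n\<close>.\<close>

definition eliminate :: "nat \<Rightarrow> (nat \<Rightarrow> real) set \<Rightarrow> (nat \<Rightarrow> real) set" where
  "eliminate n T = {a \<in> T. a n = 0} \<union>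
     (\<lambda>(a, b) i. a i / a n - b i / b n) ` ({a \<in> T. a n \<noteq> 0} \<times> {b \<in> T. b n \<noteq> 0})"

text \<open>The elements of level \<open>k\<close> are functionals in the first \<open>k\<close> coordinates only.\<close>

primrec elimination_closure :: "nat \<Rightarrow> (nat \<Rightarrow> real) set \<Rightarrow> (nat \<times> (nat \<Rightarrow> real)) set" where
  "elimination_closure 0 T = {}"
| "elimination_closure (Suc n) T = {Suc n} \<times> T \<union> elimination_closure n (eliminate n T)"

text \<open>Signs are compared on all levels, as in a cylindrical decomposition: the signs of the
  eliminated functionals fix the order of the thresholds. For finite \<open>T\<close> the number of
  cells is bounded in terms of \<open>n\<close> and \<open>card T\<close> alone.\<close>

definition same_cell ::
  "(nat \<Rightarrow> 'x \<Rightarrow> real) \<Rightarrow> nat \<Rightarrow> (nat \<Rightarrow> real) set \<Rightarrow> 'x \<Rightarrow> 'x \<Rightarrow> bool" where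
  "same_cell \<phi> n T x y \<longleftrightarrow>
     (\<forall>(k, a) \<in> elimination_closure n T. sgn (lin \<phi> k a x) = sgn (lin \<phi> k a y))"

text \<open>The argument \<open>j + j * j\<close> bounds the size of \<open>eliminate n T\<close>
  when \<open>j = card T\<close>. Only \<open>j = 2 * n\<close> matters later, where the value is a
  constant depending on \<open>n\<close>.\<close>

primrec closure_bound :: "nat \<Rightarrow> nat \<Rightarrow> nat" where
  "closure_bound 0 j = 0"
| "closure_bound (Suc n) j = j + closure_bound n (j + j * j)"

lemma closure_bound_mono: "i \<le> j \<Longrightarrow> closure_bound n i \<le> closure_bound n j"
proof (induction n arbitrary: i j)
  case (Suc n)
  then have "closure_bound n (i + i * i) \<le> closure_bound n (j + j * j)"
    by (intro Suc.IH add_mono mult_mono) auto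
  then show ?case using Suc.prems by simp
qed simp

lemma finite_eliminate: "finite T \<Longrightarrow> finite (eliminate n T)"
  by (simp add: eliminate_def)

lemma card_eliminate_le:
  assumes "finite T"
  shows "card (eliminate n T) \<le> card T + card T * card T"
proof -
  have "card (eliminate n T) \<le> card {a \<in> T. a n = 0} + card ({a \<in> T. a n \<noteq> 0} \<times> {b \<in> T. b n \<noteq> 0})"
    unfolding eliminate_def using assms
    by (intro order.trans[OF card_Un_le] add_mono card_image_le) auto
  also have "\<dots> \<le> card T + card T * card T"
    unfolding card_cartesian_product using assms by (intro add_mono mult_mono card_mono) auto
  finally show ?thesis .
qed

lemma eliminate_mono: "S \<subseteq> T \<Longrightarrow> eliminate n S \<subseteq> eliminate n T"
  by (auto simp: eliminate_def)

lemma elimination_closure_mono: "S \<subseteq> T \<Longrightarrow> elimination_closure n S \<subseteq> elimination_closure n T"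
proof (induction n arbitrary: S T)
  case (Suc n)
  have "elimination_closure n (eliminate n S) \<subseteq> elimination_closure n (eliminate n T)"
    by (intro Suc.IH eliminate_mono Suc.prems)
  then show ?case using Suc.prems by (simp add: le_supI1 le_supI2 Sigma_mono)
qed simp

lemma elimination_closure_finite_card:
  assumes "finite T"
  shows "finite (elimination_closure n T) \<and> card (elimination_closure n T) \<le> closure_bound n (card T)"
  using assms
proof (induction n arbitrary: T)
  case (Suc n)
  note IH = Suc.IH[OF finite_eliminate[OF Suc.prems, of n]]
  have "card (elimination_closure (Suc n) T) \<le> card T + card (elimination_closure n (eliminate n T))"
    using card_Un_le[of "{Suc n} \<times> T" "elimination_closure n (eliminate n T)"]
    by (simp add: card_cartesian_product)
  also have "\<dots> \<le> card T + closure_bound n (card T + card T * card T)"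
    using IH closure_bound_mono[OF card_eliminate_le[OF Suc.prems, of n], of n] by linarith
  finally show ?case using IH Suc.prems by simp
qed simp

lemma same_cell_antimono: "S \<subseteq> T \<Longrightarrow> same_cell \<phi> n T x y \<Longrightarrow> same_cell \<phi> n S x y"
  using elimination_closure_mono unfolding same_cell_def by blast

lemma lin_Suc: "lin \<phi> (Suc n) a x = lin \<phi> n a x + a n * \<phi> n x"
  by (simp add: lin_def)

lemma lin_diff_div:
  "lin \<phi> n (\<lambda>i. a i / s - b i / t) x = lin \<phi> n a x / s - lin \<phi> n b x / t"
  by (simp add: lin_def sum_divide_distrib left_diff_distrib sum_subtractf)

text \<open>A set with at most one element replaces the minimizer itself, so that an empty
  \<open>U\<close> needs no separate case in the application.\<close>

lemma ex_minimizer: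
  fixes f :: "'a \<Rightarrow> real"
  assumes "finite U"
  shows "\<exists>P\<subseteq>U. card P \<le> 1 \<and> (\<forall>a\<in>U. \<exists>b\<in>P. f b \<le> f a)"
proof (cases "U = {}")
  case False
  then have "\<forall>a\<in>U. f (arg_min_on f U) \<le> f a"
    using assms arg_min_least by metis
  then show ?thesis
    using arg_min_if_finite(1)[OF assms False]
    by (intro exI[of _ "{arg_min_on f U}"]) auto
qed auto

lemma sgn_lin_pivot:
  assumes "a n \<noteq> (0::real)"
  shows "sgn (lin \<phi> (Suc n) a x) = sgn (a n) * sgn (\<phi> n x - (- lin \<phi> n a x / a n))"
proof -
  have "lin \<phi> (Suc n) a x = a n * (\<phi> n x - (- lin \<phi> n a x / a n))"
    using assms by (simp add: lin_Suc field_simps)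
  then show ?thesis by (simp only: sgn_mult)
qed

text \<open>With pivot \<open>\<phi> n\<close>, every functional with nonzero \<open>n\<close>-th coefficient bounds \<open>\<phi> n x\<close> by a functional
  in the lower coordinates. Only the tightest bounds at \<open>x\<close> from either side and their differences
  to the other bounds matter; these differences are handled by the induction hypothesis.\<close>

lemma ex_uncrossed_cell:
  assumes "finite R"
  shows "\<exists>T\<subseteq>R. card T \<le> 2 * n \<and>
    (\<forall>y. same_cell \<phi> n T x y \<longrightarrow> (\<forall>a\<in>R. sgn (lin \<phi> n a x) = sgn (lin \<phi> n a y)))"
  using assms
proof (induction n arbitrary: R)
  case 0
  then show ?case by (intro exI[of _ "{}"]) (simp add: lin_def)
next
  case (Suc n)
  \<comment> \<open>For \<open>a\<close> in \<open>N\<close> this is the threshold: the value of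
    \<open>\<phi> n y\<close> at which \<open>a\<close> vanishes.\<close>
  define h where "h a y = - lin \<phi> n a y / a n" for a y
  define N where "N = {a \<in> R. a n \<noteq> 0}"
  have pivot: "sgn (lin \<phi> (Suc n) a y) = sgn (a n) * sgn (\<phi> n y - h a y)" if "a \<in> N" for a y
    using sgn_lin_pivot[of a n \<phi> y] that unfolding N_def h_def by simp
  have fin: "finite {a \<in> N. \<phi> n x \<le> h a x}" "finite {a \<in> N. h a x < \<phi> n x}"
    using Suc.prems by (auto simp: N_def)
  \<comment> \<open>\<open>P1\<close> takes the lowest threshold at or above
    \<open>\<phi> n x\<close>, and \<open>P2\<close> the highest one strictly below, found by
    minimizing the negative. Ties thus belong to \<open>P1\<close>.\<close>
  obtain P1 where P1: "P1 \<subseteq> {a \<in> N. \<phi> n x \<le> h a x}" "card P1 \<le> 1"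
    "\<And>a. a \<in> N \<Longrightarrow> \<phi> n x \<le> h a x \<Longrightarrow> \<exists>b\<in>P1. h b x \<le> h a x"
    using ex_minimizer[OF fin(1), of "\<lambda>a. h a x"] by auto
  obtain P2 where P2: "P2 \<subseteq> {a \<in> N. h a x < \<phi> n x}" "card P2 \<le> 1"
    "\<And>a. a \<in> N \<Longrightarrow> h a x < \<phi> n x \<Longrightarrow> \<exists>b\<in>P2. h a x \<le> h b x"
    using ex_minimizer[OF fin(2), of "\<lambda>a. - h a x"] by auto
  define P where "P = P1 \<union> P2"
  have P: "P \<subseteq> N" "card P \<le> 2" "finite P"
    using P1(1,2) P2(1,2) card_Un_le[of P1 P2] finite_subset[OF P1(1) fin(1)]
      finite_subset[OF P2(1) fin(2)]
    unfolding P_def by auto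
  define df :: "(nat \<Rightarrow> real) \<Rightarrow> (nat \<Rightarrow> real) \<Rightarrow> nat \<Rightarrow> real"
    where "df a b = (\<lambda>i. a i / a n - b i / b n)" for a b
  have lin_df: "lin \<phi> n (df a b) y = h b y - h a y" for a b y
    by (simp add: df_def lin_diff_div h_def)
  define R' where "R' = {a \<in> R. a n = 0} \<union> (\<lambda>(a, b). df a b) ` (N \<times> P)"
  have "finite R'" using Suc.prems P by (auto simp: R'_def N_def)
  then obtain T' where T': "T' \<subseteq> R'" "card T' \<le> 2 * n"
    "\<And>y a. same_cell \<phi> n T' x y \<Longrightarrow> a \<in> R' \<Longrightarrow> sgn (lin \<phi> n a x) = sgn (lin \<phi> n a y)"
    using Suc.IH[of R'] by blast
  \<comment> \<open>Apart from \<open>P\<close>, each member of \<open>T'\<close> involves a single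
    functional of \<open>R\<close>. So \<open>T\<close> needs at most \<open>2 * n\<close>
    functionals for \<open>T'\<close> and two more for \<open>P\<close>.\<close>
  have "\<forall>d\<in>T'. \<exists>a\<in>R. (d = a \<and> a n = 0) \<or> (a \<in> N \<and> (\<exists>b\<in>P. d = df a b))"
    using T'(1) unfolding R'_def N_def by fastforce
  then obtain src where src: "\<And>d. d \<in> T' \<Longrightarrow> src d \<in> R \<and>
      ((d = src d \<and> src d n = 0) \<or> (src d \<in> N \<and> (\<exists>b\<in>P. d = df (src d) b)))"
    by metis
  define T where "T = src ` T' \<union> P"
  have "finite T'" using T'(1) \<open>finite R'\<close> finite_subset by blast
  then have "card T \<le> 2 * Suc n"
    unfolding T_def using card_Un_le[of "src ` T'" P] card_image_le[OF \<open>finite T'\<close>, of src] T'(2) P(2) by simp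
  have "T \<subseteq> R" using src P(1) by (auto simp: T_def N_def)
  have T'_eliminate: "T' \<subseteq> eliminate n T"
  proof
    fix d assume "d \<in> T'"
    from src[OF this] consider "d = src d" "src d n = 0" |
      b where "src d \<in> N" "b \<in> P" "d = df (src d) b" by blast
    then show "d \<in> eliminate n T"
    proof cases
      case 1
      then have "d \<in> {a \<in> T. a n = 0}" using \<open>d \<in> T'\<close> by (auto simp: T_def intro: rev_image_eqI)
      then show ?thesis by (simp add: eliminate_def)
    next
      case 2
      then have "(src d, b) \<in> {a \<in> T. a n \<noteq> 0} \<times> {b \<in> T. b n \<noteq> 0}"
        using \<open>d \<in> T'\<close> P(1) by (auto simp: T_def N_def)
      then have "df (src d) b \<in> eliminate n T" unfolding eliminate_def df_def by force
      then show ?thesis using 2(3) by simp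
    qed
  qed
  have "sgn (lin \<phi> (Suc n) a x) = sgn (lin \<phi> (Suc n) a y)"
    if same: "same_cell \<phi> (Suc n) T x y" and "a \<in> R" for a y
  proof -
    have "same_cell \<phi> n (eliminate n T) x y" using same by (auto simp: same_cell_def)
    then have R'_eq: "sgn (lin \<phi> n b x) = sgn (lin \<phi> n b y)" if "b \<in> R'" for b
      using T'(3)[OF same_cell_antimono[OF T'_eliminate] that] by simp
    have P_eq: "sgn (\<phi> n x - h b x) = sgn (\<phi> n y - h b y)" if "b \<in> P" for b
    proof -
      have "sgn (lin \<phi> (Suc n) b x) = sgn (lin \<phi> (Suc n) b y)"
        using same that by (auto simp: same_cell_def T_def)
      moreover have "b \<in> N" "sgn (b n) \<noteq> 0" using that P(1) by (auto simp: N_def sgn_0_0)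
      ultimately show ?thesis using pivot by simp
    qed
    show ?thesis
    proof (cases "a n = 0")
      case True
      then show ?thesis using R'_eq[of a] \<open>a \<in> R\<close> by (simp add: R'_def lin_Suc)
    next
      case False
      then have "a \<in> N" using \<open>a \<in> R\<close> by (simp add: N_def)
      have diff_eq: "sgn (h b x - h a x) = sgn (h b y - h a y)" if "b \<in> P" for b
      proof -
        have "df a b \<in> R'" using that \<open>a \<in> N\<close> unfolding R'_def by auto
        then show ?thesis using R'_eq lin_df by metis
      qed
      have "sgn (\<phi> n x - h a x) = sgn (\<phi> n y - h a y)"
      proof (cases "\<phi> n x \<le> h a x")
        \<comment> \<open>The threshold of \<open>b\<close> lies between \<open>\<phi> n x\<close>
          and the threshold of \<open>a\<close>. Both comparisons have the same sign at
          \<open>y\<close>, so transitivity determines the sign there. The other case is the mirror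
          image.\<close>
        case True
        then obtain b where b: "b \<in> P1" "h b x \<le> h a x" using P1(3) \<open>a \<in> N\<close> by blast
        then have "\<phi> n x \<le> h b x" "b \<in> P" using P1(1) by (auto simp: P_def)
        then show ?thesis using diff_eq[of b] P_eq[of b] b(2)
          by (auto simp: sgn_if split: if_splits)
      next
        case False
        then obtain b where b: "b \<in> P2" "h a x \<le> h b x" using P2(3)[of a] \<open>a \<in> N\<close> by force
        then have "h b x < \<phi> n x" "b \<in> P" using P2(1) by (auto simp: P_def)
        then show ?thesis using diff_eq[of b] P_eq[of b] b(2)
          by (auto simp: sgn_if split: if_splits)
      qed
      then show ?thesis using pivot[OF \<open>a \<in> N\<close>] by simp
    qed
  qed
  then show ?case using \<open>T \<subseteq> R\<close> \<open>card T \<le> 2 * Suc n\<close> by blast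
qed

section \<open>Hitting sets and large cells\<close>

text \<open>Greedy choice: by double counting, some point of \<open>B\<close> lies in at least a
  fraction \<open>\<delta>\<close> of the sets, and choosing it leaves at most
  \<open>(1 - \<delta>) * card F\<close> of them. After \<open>l\<close> choices fewer than one set
  remains.\<close>

lemma ex_hitting_set:
  fixes \<delta> :: real
  assumes "finite B" "finite F" "0 \<le> \<delta>" "\<delta> \<le> 1" "(1 - \<delta>) ^ l * card F < 1"
    and "\<And>S. S \<in> F \<Longrightarrow> S \<subseteq> B \<and> S \<noteq> {} \<and> \<delta> * card B \<le> card S"
  shows "\<exists>R\<subseteq>B. card R \<le> l \<and> (\<forall>S\<in>F. S \<inter> R \<noteq> {})"
  using assms(2,5,6)
proof (induction l arbitrary: F)
  case 0
  then have "F = {}" by (simp add: card_eq_0_iff)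
  then show ?case by (intro exI[of _ "{}"]) auto
next
  case (Suc l)
  show ?case
  proof (cases "F = {}")
    case False
    have ex: "\<exists>b\<in>B. \<delta> * card F \<le> card {S \<in> F. b \<in> S}"
    proof (rule ccontr)
      assume "\<not> ?thesis"
      then have less: "real (card {S \<in> F. b \<in> S}) < \<delta> * card F" if "b \<in> B" for b
        using that by force
      have "B \<noteq> {}" using False Suc.prems(3) by blast
      have "(\<Sum>b\<in>B. card {S \<in> F. b \<in> S}) = (\<Sum>S\<in>F. card {b \<in> B. b \<in> S})"
        using sum_multicount_gen[OF Suc.prems(1) assms(1), of "\<lambda>S b. b \<in> S"
            "\<lambda>b. card {S \<in> F. b \<in> S}"] by simp
      also have "\<dots> = (\<Sum>S\<in>F. card S)"
        using Suc.prems(3) by (intro sum.cong arg_cong[of _ _ card]) blast+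
      finally have "(\<Sum>b\<in>B. real (card {S \<in> F. b \<in> S})) = (\<Sum>S\<in>F. real (card S))"
        by (metis of_nat_sum)
      also have "\<dots> \<ge> (\<Sum>S\<in>F. \<delta> * card B)"
        using Suc.prems(3) by (intro sum_mono) blast
      finally have "(\<Sum>b\<in>B. \<delta> * card F) \<le> (\<Sum>b\<in>B. real (card {S \<in> F. b \<in> S}))"
        by (simp add: mult_ac)
      moreover have "(\<Sum>b\<in>B. real (card {S \<in> F. b \<in> S})) < (\<Sum>b\<in>B. \<delta> * card F)"
        using less \<open>B \<noteq> {}\<close> assms(1) by (intro sum_strict_mono) auto
      ultimately show False by simp
    qed
    then obtain b where b: "b \<in> B" "\<delta> * card F \<le> card {S \<in> F. b \<in> S}" by blast
    define F' where "F' = {S \<in> F. b \<notin> S}"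
    have "card F = card F' + card {S \<in> F. b \<in> S}"
      unfolding F'_def using Suc.prems(1)
      by (subst card_Un_disjoint[symmetric]) (auto intro: arg_cong[of _ _ card])
    then have "card F' \<le> (1 - \<delta>) * card F" using b(2) by (simp add: algebra_simps)
    then have "(1 - \<delta>) ^ l * card F' \<le> (1 - \<delta>) ^ l * ((1 - \<delta>) * card F)"
      using assms(4) by (intro mult_left_mono) auto
    also have "\<dots> < 1" using Suc.prems(2) by (simp add: mult_ac)
    finally obtain R where R: "R \<subseteq> B" "card R \<le> l" "\<forall>S\<in>F'. S \<inter> R \<noteq> {}"
      using Suc.IH[of F'] Suc.prems(1,3) unfolding F'_def by auto
    have "card (insert b R) \<le> Suc l"
      using R(2) card_insert_le_m1[of "Suc l" R b] by simp
    then show ?thesis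
      using b(1) R(1,3) by (intro exI[of _ "insert b R"]) (auto simp: F'_def)
  qed auto
qed

text \<open>A small subset is coded as a list of length exactly \<open>k\<close>, padded with
  \<open>None\<close>; hence the base \<open>card A + 1\<close>.\<close>

lemma card_small_subsets_le:
  assumes "finite A"
  shows "card {T. T \<subseteq> A \<and> card T \<le> k} \<le> (card A + 1) ^ k"
proof -
  define L where "L = {xs. set xs \<subseteq> insert None (Some ` A) \<and> length xs = k}"
  have "{T. T \<subseteq> A \<and> card T \<le> k} \<subseteq> (\<lambda>xs. {a. Some a \<in> set xs}) ` L"
  proof
    fix T assume "T \<in> {T. T \<subseteq> A \<and> card T \<le> k}"
    then have T: "T \<subseteq> A" "card T \<le> k" "finite T" using assms finite_subset by auto
    obtain ys where ys: "set ys = T" "distinct ys" using finite_distinct_list[OF T(3)] by blast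
    then have len: "length ys \<le> k" using T(2) distinct_card by metis
    define xs where "xs = map Some ys @ replicate (k - length ys) None"
    have "xs \<in> L" using len ys T(1) by (auto simp: L_def xs_def)
    moreover have "T = {a. Some a \<in> set xs}" using ys by (auto simp: xs_def)
    ultimately show "T \<in> (\<lambda>xs. {a. Some a \<in> set xs}) ` L" by blast
  qed
  then have "card {T. T \<subseteq> A \<and> card T \<le> k} \<le> card L"
    using assms by (intro surj_card_le) (auto simp: L_def intro: finite_lists_length_eq)
  also have "\<dots> = card (insert None (Some ` A)) ^ k"
    unfolding L_def using assms by (intro card_lists_length_eq) auto
  also have "\<dots> = (card A + 1) ^ k"
    using assms by (subst card_insert_disjoint) (auto simp: card_image)
  finally show ?thesis .
qed

text \<open>Signs are three-valued, so \<open>A\<close> is also crossed when a functional vanishes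
  on only part of it.\<close>

definition crosses ::
  "(nat \<Rightarrow> 'x \<Rightarrow> real) \<Rightarrow> nat \<Rightarrow> (nat \<Rightarrow> real) set \<Rightarrow> 'x set \<Rightarrow> bool" where
  "crosses \<phi> n H A \<longleftrightarrow>
     (\<exists>a\<in>H. \<exists>x\<in>A. \<exists>y\<in>A. sgn (lin \<phi> n a x) \<noteq> sgn (lin \<phi> n a y))"

lemma crosses_mono: "A \<subseteq> B \<Longrightarrow> crosses \<phi> n H A \<Longrightarrow> crosses \<phi> n H B"
  by (auto simp: crosses_def)

text \<open>Pigeonhole on the pairs formed by \<open>T x\<close> and the sign vector of
  \<open>x\<close> on its closure. There are at most \<open>(card R + 1) ^ k\<close> choices of the
  set, each with at most \<open>3 ^ closure_bound n k\<close> sign vectors.\<close>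

lemma ex_large_cell:
  assumes "finite X"
    and T: "\<And>x. x \<in> X \<Longrightarrow> T x \<subseteq> R \<and> card (T x) \<le> k" and "finite R"
  shows "X = {} \<or> (\<exists>x\<in>X. card X \<le> (card R + 1) ^ k * 3 ^ closure_bound n k *
      card {y \<in> X. same_cell \<phi> n (T x) x y})"
proof (cases "X = {}")
  case False
  define sig where "sig S x = restrict (\<lambda>(j, a). sgn (lin \<phi> j a x)) (elimination_closure n S)" for S x
  define TT where "TT = {S. S \<subseteq> R \<and> card S \<le> k}"
  define K where "K = Sigma TT (\<lambda>S. elimination_closure n S \<rightarrow>\<^sub>E {-1, 0, 1::real})"
  have "finite TT" using assms(3) by (simp add: TT_def)
  have fin_cl: "finite (elimination_closure n S)" "card (elimination_closure n S) \<le> closure_bound n k"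
    if "S \<in> TT" for S
  proof -
    have "finite S" "card S \<le> k" using that assms(3) finite_subset by (auto simp: TT_def)
    then show "finite (elimination_closure n S)" "card (elimination_closure n S) \<le> closure_bound n k"
      using elimination_closure_finite_card[of S n] closure_bound_mono[of "card S" k n] by auto
  qed
  have "finite K" unfolding K_def using \<open>finite TT\<close> fin_cl(1) by (intro finite_SigmaI finite_PiE) auto
  have "card K = (\<Sum>S\<in>TT. card (elimination_closure n S \<rightarrow>\<^sub>E {-1, 0, 1::real}))"
    unfolding K_def using \<open>finite TT\<close> fin_cl(1) by (intro card_SigmaI ballI finite_PiE) auto
  also have "\<dots> \<le> (\<Sum>S\<in>TT. 3 ^ closure_bound n k)"
    using fin_cl by (intro sum_mono) (simp add: card_PiE power_increasing[of _ _ 3] flip: numeral_3_eq_3)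
  also have "\<dots> \<le> (card R + 1) ^ k * 3 ^ closure_bound n k"
    using card_small_subsets_le[OF assms(3), of k] by (simp add: TT_def)
  finally have "card K \<le> (card R + 1) ^ k * 3 ^ closure_bound n k" .
  define f where "f x = (T x, sig (T x) x)" for x
  have "f \<in> X \<rightarrow> K"
    using T by (auto simp: f_def K_def TT_def sig_def sgn_if split: if_splits)
  moreover have "K \<noteq> {}" using False calculation by blast
  ultimately obtain q where q: "card X \<le> card (f -` {q} \<inter> X) * card K"
    using pigeonhole_card[OF _ assms(1) \<open>finite K\<close>] by blast
  have "card X \<noteq> 0" using False assms(1) by simp
  then have "f -` {q} \<inter> X \<noteq> {}" using q by (metis card.empty le_zero_eq mult_0)
  then obtain x where x: "x \<in> X" "f x = q" by blast
  have "f -` {q} \<inter> X \<subseteq> {y \<in> X. same_cell \<phi> n (T x) x y}"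
  proof
    fix y assume "y \<in> f -` {q} \<inter> X"
    then have "y \<in> X" and eq: "T y = T x" "sig (T x) x = sig (T x) y"
      using x by (auto simp: f_def)
    have "same_cell \<phi> n (T x) x y"
      unfolding same_cell_def using eq(2)
      by (auto simp: sig_def restrict_def fun_eq_iff split: if_splits)
    then show "y \<in> {y \<in> X. same_cell \<phi> n (T x) x y}" using \<open>y \<in> X\<close> by simp
  qed
  then have "card (f -` {q} \<inter> X) \<le> card {y \<in> X. same_cell \<phi> n (T x) x y}"
    using assms(1) by (intro card_mono) auto
  then have "card X \<le> (card R + 1) ^ k * 3 ^ closure_bound n k * card {y \<in> X. same_cell \<phi> n (T x) x y}"
    using order.trans[OF q mult_le_mono[OF _ \<open>card K \<le> _\<close>]] by (simp only: mult.commute)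
  then show ?thesis using x(1) by blast
qed simp

text \<open>The random sample of the usual cutting lemma is replaced by a hitting set for all potential cells
  that are crossed too often. It costs a factor \<open>ln (card V)\<close>, which is harmless here. Several
  ground sets \<open>B i\<close> are treated at once so that sets of very different sizes all stay mostly
  uncrossed.\<close>

lemma cutting:
  fixes H :: "'v \<Rightarrow> (nat \<Rightarrow> real) set" and X :: "'x set" and \<delta> :: real
  assumes "finite X" "finite V" "finite J" "card J \<le> k"
    and B: "\<And>i. i \<in> J \<Longrightarrow> B i \<subseteq> V"
    and H: "\<And>v. v \<in> V \<Longrightarrow> finite (H v) \<and> card (H v) \<le> w"
    and \<delta>: "0 \<le> \<delta>" "\<delta> \<le> 1"
    and l: "(1 - \<delta>) ^ l * real ((card V * w + 1) ^ (2 * n) * card X) < 1"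
  shows "\<exists>A\<subseteq>X. card X \<le> (k * l * w + 1) ^ (2 * n) * 3 ^ closure_bound n (2 * n) * card A \<and>
    (\<forall>i\<in>J. card {v \<in> B i. crosses \<phi> n (H v) A} \<le> \<delta> * card (B i))"
proof -
  define cell where "cell T x = {y \<in> X. same_cell \<phi> n T x y}" for T x
  define cr where "cr T x i = {v \<in> B i. crosses \<phi> n (H v) (cell T x)}" for T x i
  define U where "U = (\<Union>v\<in>V. H v)"
  have UN_bound: "finite (\<Union>v\<in>S. H v)" "card (\<Union>v\<in>S. H v) \<le> card S * w" if "S \<subseteq> V" for S
  proof -
    have "finite S" using that assms(2) finite_subset by blast
    then show "finite (\<Union>v\<in>S. H v)" using that H by blast
    have "card (\<Union>v\<in>S. H v) \<le> (\<Sum>v\<in>S. card (H v))" by (rule card_UN_le[OF \<open>finite S\<close>])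
    also have "\<dots> \<le> card S * w" using that H sum_bounded_above[of S "\<lambda>v. card (H v)" w] by auto
    finally show "card (\<Union>v\<in>S. H v) \<le> card S * w" .
  qed
  have finU: "finite U" "card U \<le> card V * w" using UN_bound[of V] by (auto simp: U_def)
  define TT where "TT = {T. T \<subseteq> U \<and> card T \<le> 2 * n}"
  have TT: "finite TT" "card TT \<le> (card V * w + 1) ^ (2 * n)"
    using finU(1) order.trans[OF card_small_subsets_le[OF finU(1)] power_mono] finU(2)
    by (simp_all add: TT_def)
  \<comment> \<open>The too heavily crossed cells are collected over all candidate sets
    \<open>T\<close> of functionals, because the hitting sets must be fixed before the actual cells
    are known.\<close>
  define F where "F i = {S \<in> (\<lambda>(T, x). cr T x i) ` (TT \<times> X). \<delta> * card (B i) < card S}" for i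
  have "\<exists>R\<subseteq>B i. card R \<le> l \<and> (\<forall>S\<in>F i. S \<inter> R \<noteq> {})" if "i \<in> J" for i
  proof (rule ex_hitting_set[OF _ _ \<delta>])
    show "finite (B i)" using B[OF that] assms(2) finite_subset by blast
    show "finite (F i)" unfolding F_def using TT(1) assms(1) by auto
    have "card (F i) \<le> card ((\<lambda>(T, x). cr T x i) ` (TT \<times> X))"
      unfolding F_def using TT(1) assms(1) by (intro card_mono) auto
    also have "\<dots> \<le> card (TT \<times> X)" using TT(1) assms(1) by (intro card_image_le) auto
    also have "\<dots> \<le> (card V * w + 1) ^ (2 * n) * card X"
      unfolding card_cartesian_product using TT(2) by (intro mult_mono) auto
    finally have "(1 - \<delta>) ^ l * card (F i) \<le> (1 - \<delta>) ^ l * real ((card V * w + 1) ^ (2 * n) * card X)"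
      using \<delta> by (intro mult_left_mono) (auto simp del: of_nat_mult of_nat_power)
    then show "(1 - \<delta>) ^ l * card (F i) < 1" using l by linarith
    show "S \<subseteq> B i \<and> S \<noteq> {} \<and> \<delta> * card (B i) \<le> card S" if "S \<in> F i" for S
    proof -
      have "0 \<le> \<delta> * card (B i)" using \<delta> by simp
      then show ?thesis using that by (auto simp: F_def cr_def)
    qed
  qed
  then obtain R0 where R0: "\<And>i. i \<in> J \<Longrightarrow> R0 i \<subseteq> B i" "\<And>i. i \<in> J \<Longrightarrow> card (R0 i) \<le> l"
    "\<And>i S. i \<in> J \<Longrightarrow> S \<in> F i \<Longrightarrow> S \<inter> R0 i \<noteq> {}"
    by metis
  \<comment> \<open>All functionals of the points in the hitting sets; the cells are then chosen so
    that no functional in \<open>R\<close> crosses them.\<close>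
  define R where "R = (\<Union>v\<in>(\<Union>i\<in>J. R0 i). H v)"
  have R0V: "(\<Union>i\<in>J. R0 i) \<subseteq> V" using R0(1) B by blast
  have "card (\<Union>i\<in>J. R0 i) \<le> (\<Sum>i\<in>J. card (R0 i))" by (rule card_UN_le[OF assms(3)])
  also have "\<dots> \<le> card J * l" using R0(2) sum_bounded_above[of J "\<lambda>i. card (R0 i)" l] by auto
  also have "\<dots> \<le> k * l" using assms(4) by simp
  finally have "card (\<Union>i\<in>J. R0 i) \<le> k * l" .
  then have "card R \<le> k * l * w"
    unfolding R_def by (intro order.trans[OF UN_bound(2)[OF R0V]] mult_le_mono1)
  have "finite R" unfolding R_def by (rule UN_bound(1)[OF R0V])
  have "R \<subseteq> U" using R0V by (auto simp: R_def U_def)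
  have "\<forall>x. \<exists>T. T \<subseteq> R \<and> card T \<le> 2 * n \<and> (\<forall>y. same_cell \<phi> n T x y \<longrightarrow>
      (\<forall>a\<in>R. sgn (lin \<phi> n a x) = sgn (lin \<phi> n a y)))"
    by (intro allI ex_uncrossed_cell[OF \<open>finite R\<close>])
  from choice[OF this] obtain T where T_all: "\<forall>x. T x \<subseteq> R \<and> card (T x) \<le> 2 * n \<and>
      (\<forall>y. same_cell \<phi> n (T x) x y \<longrightarrow> (\<forall>a\<in>R. sgn (lin \<phi> n a x) = sgn (lin \<phi> n a y)))" ..
  then have T: "T x \<subseteq> R" "card (T x) \<le> 2 * n"
    "same_cell \<phi> n (T x) x y \<Longrightarrow> a \<in> R \<Longrightarrow> sgn (lin \<phi> n a x) = sgn (lin \<phi> n a y)" for x y a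
    by simp_all
  \<comment> \<open>A heavy crossing set would meet \<open>R0 i\<close> in some \<open>v\<close>.
    But \<open>H v\<close> lies in \<open>R\<close>, and no member of \<open>R\<close> changes sign
    on the cell.\<close>
  have light: "card (cr (T x) x i) \<le> \<delta> * card (B i)" if "x \<in> X" and i: "i \<in> J" for x i
  proof (rule ccontr)
    assume heavy: "\<not> ?thesis"
    have "T x \<in> TT" using T(1,2) \<open>R \<subseteq> U\<close> by (fastforce simp: TT_def)
    then have "cr (T x) x i \<in> F i" using heavy that(1) by (force simp: F_def)
    then obtain v where v: "v \<in> cr (T x) x i" "v \<in> R0 i" using R0(3) i by blast
    then have "H v \<subseteq> R" using i by (auto simp: R_def)
    moreover obtain a y z where a: "a \<in> H v" "same_cell \<phi> n (T x) x y" "same_cell \<phi> n (T x) x z"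
      "sgn (lin \<phi> n a y) \<noteq> sgn (lin \<phi> n a z)"
      using v(1) unfolding cr_def cell_def crosses_def by blast
    ultimately have "a \<in> R" by blast
    then show False using T(3)[OF a(2)] T(3)[OF a(3)] a(4) by simp
  qed
  show ?thesis
  proof (cases "X = {}")
    case True
    then show ?thesis using \<delta> by (intro exI[of _ "{}"]) (auto simp: crosses_def)
  next
    case False
    then obtain x where x: "x \<in> X"
      "card X \<le> (card R + 1) ^ (2 * n) * 3 ^ closure_bound n (2 * n) * card (cell (T x) x)"
      using ex_large_cell[OF assms(1) _ \<open>finite R\<close>, of T "2 * n" n \<phi>] T(1,2)
      unfolding cell_def by blast
    have "(card R + 1) ^ (2 * n) \<le> (k * l * w + 1) ^ (2 * n)"
      using \<open>card R \<le> k * l * w\<close> by (intro power_mono) auto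
    then have "card X \<le> (k * l * w + 1) ^ (2 * n) * 3 ^ closure_bound n (2 * n) * card (cell (T x) x)"
      using x(2) by (meson mult_le_mono1 order_trans)
    moreover have "cell (T x) x \<subseteq> X" by (auto simp: cell_def)
    ultimately show ?thesis using light[OF x(1)] unfolding cr_def by blast
  qed
qed

subsection \<open>Colorings determined by signs\<close>

text \<open>The semi-algebraic structure enters only through \<open>col_eqI\<close>: the signs at
  \<open>u\<close> of the functionals attached to \<open>v\<close> determine the color. Values of
  \<open>col\<close> on the diagonal carry no meaning, hence the conditions
  \<open>u \<noteq> v\<close>.\<close>

locale sign_coloring =
  fixes V :: "'x set" and col :: "'x \<Rightarrow> 'x \<Rightarrow> nat" and m :: nat
    and \<phi> :: "nat \<Rightarrow> 'x \<Rightarrow> real" and n :: nat and H :: "'x \<Rightarrow> (nat \<Rightarrow> real) set" and w :: nat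
  assumes finite_V: "finite V"
    and col_sym: "col u v = col v u"
    and col_less: "u \<in> V \<Longrightarrow> v \<in> V \<Longrightarrow> u \<noteq> v \<Longrightarrow> col u v < m"
    and H: "v \<in> V \<Longrightarrow> finite (H v) \<and> card (H v) \<le> w"
    and col_eqI: "\<lbrakk>u \<in> V; u' \<in> V; v \<in> V; u \<noteq> v; u' \<noteq> v;
      \<And>a. a \<in> H v \<Longrightarrow> sgn (lin \<phi> n a u) = sgn (lin \<phi> n a u')\<rbrakk> \<Longrightarrow> col u v = col u' v"
begin

section \<open>Uniform parts and the recursion\<close>

definition uniform :: "'x set \<Rightarrow> 'x \<Rightarrow> bool" where
  "uniform A v \<longleftrightarrow> v \<notin> A \<and> (\<exists>c. \<forall>u\<in>A. col u v = c)"

definition uniform_pair :: "'x set \<Rightarrow> 'x set \<Rightarrow> bool" where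
  "uniform_pair A B \<longleftrightarrow> A \<inter> B = {} \<and> (\<exists>c. \<forall>u\<in>A. \<forall>v\<in>B. col u v = c)"

lemma uniform_mono: "A \<subseteq> B \<Longrightarrow> uniform B v \<Longrightarrow> uniform A v"
  by (auto simp: uniform_def)

lemma uniform_pair_mono: "A \<subseteq> A' \<Longrightarrow> B \<subseteq> B' \<Longrightarrow> uniform_pair A' B' \<Longrightarrow> uniform_pair A B"
  unfolding uniform_pair_def by blast

lemma uniform_if_not_crosses:
  assumes "A \<subseteq> V" "v \<in> V" "v \<notin> A" "\<not> crosses \<phi> n (H v) A"
  shows "uniform A v"
proof -
  have "col u v = col (SOME u. u \<in> A) v" if "u \<in> A" for u
  proof (rule col_eqI)
    have "(SOME u. u \<in> A) \<in> A" using that by (rule someI)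
    then show "u \<in> V" "(SOME u. u \<in> A) \<in> V" "v \<in> V" "u \<noteq> v" "(SOME u. u \<in> A) \<noteq> v"
      using assms(1-3) that by blast+
    show "sgn (lin \<phi> n a u) = sgn (lin \<phi> n a (SOME u. u \<in> A))" if "a \<in> H v" for a
      using assms(4) that \<open>u \<in> A\<close> \<open>(SOME u. u \<in> A) \<in> A\<close> unfolding crosses_def by blast
  qed
  then show ?thesis using assms(3) by (simp add: uniform_def)
qed

text \<open>Uniformity in each direction allows moving one endpoint at a time, from
  \<open>(u, v)\<close> to \<open>(u', v)\<close> and then to \<open>(u', v')\<close>. The second
  move uses the symmetry of \<open>col\<close>.\<close>

lemma uniform_pairI:
  assumes "\<And>v. v \<in> B \<Longrightarrow> uniform A v" "\<And>u. u \<in> A \<Longrightarrow> uniform B u"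
  shows "uniform_pair A B"
proof -
  have "col u v = col u' v'" if "u \<in> A" "u' \<in> A" "v \<in> B" "v' \<in> B" for u u' v v'
  proof -
    have "col u v = col u' v" using assms(1)[OF that(3)] that(1,2) by (auto simp: uniform_def)
    also have "col v u' = col v' u'" using assms(2)[OF that(2)] that(3,4) by (auto simp: uniform_def)
    then have "col u' v = col u' v'" by (simp only: col_sym[of u'])
    finally show ?thesis .
  qed
  then have "\<forall>u\<in>A. \<forall>v\<in>B. col u v = col (SOME u. u \<in> A) (SOME v. v \<in> B)"
    by (meson someI)
  moreover have "A \<inter> B = {}" using assms(1) by (auto simp: uniform_def)
  ultimately show ?thesis unfolding uniform_pair_def by (intro conjI exI)
qed

text \<open>The parts are chosen one after the other. Each new part inside \<open>Y\<close> is a cell crossed by few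
  points of \<open>Y\<close> and of every earlier part; those points are discarded.\<close>

lemma ex_uniform_parts_upto:
  fixes k l L :: nat
  defines "M \<equiv> (k * l * w + 1) ^ (2 * n) * 3 ^ closure_bound n (2 * n)"
  assumes "X \<subseteq> V" "k \<ge> 1"
    and l: "(1 - 1 / (4 * k)) ^ l * real ((card V * w + 1) ^ (2 * n) * card V) < 1"
    and L: "2 * M * L \<le> card X" "4 * k * L \<le> card X"
    and "j \<le> k"
  shows "\<exists>A Y. Y \<subseteq> X \<and> card X * (1 - j / (2 * k)) \<le> card Y \<and>
    (\<forall>i<j. A i \<subseteq> X \<and> card (A i) \<le> L \<and> L * (1 - j / (4 * k)) \<le> card (A i) \<and>
      (\<forall>y\<in>Y. uniform (A i) y)) \<and>
    (\<forall>i<j. \<forall>i'<i. uniform_pair (A i') (A i))"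
    (is "\<exists>A Y. ?P j A Y")
  using \<open>j \<le> k\<close>
proof (induction j)
  case 0
  then show ?case by (intro exI[of _ "\<lambda>_. {}"] exI[of _ X]) simp
next
  case (Suc j)
  have "finite X" using assms(2) finite_V finite_subset by blast
  obtain A Y where AY: "?P j A Y" using Suc.IH[OF Suc_leD[OF Suc.prems]] by (elim exE)
  then have Y: "Y \<subseteq> X" "card X * (1 - j / (2 * k)) \<le> card Y" by blast+
  from AY have A: "\<And>i. i < j \<Longrightarrow> A i \<subseteq> X" "\<And>i. i < j \<Longrightarrow> card (A i) \<le> L"
      "\<And>i. i < j \<Longrightarrow> L * (1 - j / (4 * k)) \<le> card (A i)"
      "\<And>i y. i < j \<Longrightarrow> y \<in> Y \<Longrightarrow> uniform (A i) y"
      "\<And>i i'. i < j \<Longrightarrow> i' < i \<Longrightarrow> uniform_pair (A i') (A i)"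
    by blast+
  have "finite Y" "Y \<subseteq> V" using Y(1) \<open>finite X\<close> assms(2) finite_subset by auto
  \<comment> \<open>The ground sets for \<open>cutting\<close>: the earlier parts at indices below
    \<open>j\<close>, and the remaining set \<open>Y\<close> at index \<open>j\<close>.\<close>
  define B where "B = A(j := Y)"
  define \<delta> where "\<delta> = 1 / real (4 * k)"
  have \<delta>: "0 \<le> \<delta>" "\<delta> \<le> 1" using assms(3) by (auto simp: \<delta>_def)
  have "card Y \<le> card V" using \<open>Y \<subseteq> V\<close> finite_V card_mono by blast
  then have "(1 - \<delta>) ^ l * real ((card V * w + 1) ^ (2 * n) * card Y)
      \<le> (1 - \<delta>) ^ l * real ((card V * w + 1) ^ (2 * n) * card V)"
    using \<delta> by (intro mult_left_mono of_nat_mono) auto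
  then have "(1 - \<delta>) ^ l * real ((card V * w + 1) ^ (2 * n) * card Y) < 1"
    using l unfolding \<delta>_def by linarith
  moreover have "B i \<subseteq> V" if "i \<in> {..j}" for i
    using that A(1)[of i] \<open>Y \<subseteq> V\<close> assms(2) by (cases "i = j") (auto simp: B_def)
  ultimately obtain C where C: "C \<subseteq> Y" "card Y \<le> M * card C"
    "\<And>i. i \<le> j \<Longrightarrow> card {v \<in> B i. crosses \<phi> n (H v) C} \<le> \<delta> * card (B i)"
    using cutting[OF \<open>finite Y\<close> finite_V, of "{..j}" k B H w \<delta> l n \<phi>] Suc.prems H \<delta>
    unfolding M_def by auto
  have "M > 0" by (simp add: M_def)
  \<comment> \<open>At least half of \<open>X\<close> is still in \<open>Y\<close>, so the cell
    found in \<open>Y\<close> has at least \<open>L\<close> points.\<close>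
  have "real j / (2 * k) \<le> 1 / 2" using Suc.prems by (simp add: field_simps)
  then have "card X * (1 / 2) \<le> card X * (1 - j / (2 * k))" by (intro mult_left_mono) auto
  then have "real (card X) \<le> 2 * real (card Y)" using Y(2) by linarith
  then have "M * L \<le> M * card C" using L(1) C(2) by linarith
  \<comment> \<open>Trimming the cell to exactly \<open>L\<close> points bounds the cost of removing
    it from \<open>Y\<close>, and bounds every later loss of this part by
    \<open>\<delta> * L\<close>.\<close>
  then obtain D where D: "D \<subseteq> C" "card D = L"
    using \<open>M > 0\<close> obtain_subset_with_card_n[of L C] by (metis mult_le_cancel1 not_gr0)
  define bad where "bad S = {v \<in> S. crosses \<phi> n (H v) D}" for S
  have card_bad: "card (bad (B i)) \<le> \<delta> * card (B i)" "finite (B i)" if "i \<le> j" for i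
  proof -
    show fin: "finite (B i)"
      using that A(1)[of i] \<open>finite X\<close> \<open>finite Y\<close> finite_subset by (cases "i = j") (auto simp: B_def)
    have "card (bad (B i)) \<le> card {v \<in> B i. crosses \<phi> n (H v) C}"
      using fin crosses_mono[OF D(1)] by (intro card_mono) (auto simp: bad_def)
    then show "card (bad (B i)) \<le> \<delta> * card (B i)" using C(3)[OF that] by linarith
  qed
  have card_rest: "(1 - \<delta>) * card (B i) \<le> card (B i - bad (B i))" if "i \<le> j" for i
  proof -
    have "card (B i - bad (B i)) = card (B i) - card (bad (B i))"
      using card_bad(2)[OF that] by (intro card_Diff_subset) (auto simp: bad_def)
    then show ?thesis using card_bad(1)[OF that] by (simp add: algebra_simps)
  qed
  have D_sub: "D \<subseteq> Y" "D \<subseteq> V" "D \<subseteq> X" "finite D"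
    using D(1) C(1) \<open>Y \<subseteq> V\<close> Y(1) finite_subset[OF _ \<open>finite Y\<close>, of D] by auto
  have unifD: "uniform D v" if "v \<in> V" "v \<notin> D" "v \<in> S" "v \<notin> bad S" for v S
    using that D_sub(2) by (intro uniform_if_not_crosses) (auto simp: bad_def)
  define Y' where "Y' = Y - bad Y - D"
  define A' where "A' = (\<lambda>i. A i - bad (A i))(j := D)"
  have kpos: "real k > 0" using assms(3) by simp
  \<comment> \<open>One round costs \<open>Y\<close> at most \<open>\<delta> * card X\<close>
    crossing points and the \<open>L \<le> \<delta> * card X\<close> points of \<open>D\<close>.
    This is \<open>card X / (2 * k)\<close> in total.\<close>
  have "card X * (1 - Suc j / (2 * k)) \<le> card Y'"
  proof -
    have "(1 - \<delta>) * card Y \<le> card (Y - bad Y)" using card_rest[of j] by (simp add: B_def)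
    moreover have "card (Y - bad Y) - card D \<le> card Y'"
      unfolding Y'_def using D_sub(4) by (rule diff_card_le_card_Diff)
    moreover have "\<delta> * card Y \<le> \<delta> * card X"
      using \<delta> Y(1) \<open>finite X\<close> by (intro mult_left_mono) (auto intro: card_mono)
    moreover have "real L \<le> \<delta> * card X"
    proof -
      have "real (4 * k * L) \<le> real (card X)" using L(2) by (rule of_nat_mono)
      then show ?thesis using kpos by (simp add: \<delta>_def field_simps)
    qed
    moreover have "card X * (1 - Suc j / (2 * k)) = card X * (1 - j / (2 * k)) - 2 * (\<delta> * card X)"
      using kpos by (simp add: \<delta>_def field_simps)
    ultimately show ?thesis using Y(2) D(2) by (simp add: algebra_simps)
  qed
  moreover have "A' i \<subseteq> X \<and> card (A' i) \<le> L \<and> L * (1 - Suc j / (4 * k)) \<le> card (A' i) \<and>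
      (\<forall>y\<in>Y'. uniform (A' i) y)" if "i < Suc j" for i
  proof (cases "i = j")
    case True
    have "L * (1 - Suc j / (4 * k)) \<le> real L * 1" by (intro mult_left_mono) auto
    moreover have "uniform D y" if "y \<in> Y'" for y
      using that unifD[of y Y] \<open>Y \<subseteq> V\<close> by (auto simp: Y'_def)
    ultimately show ?thesis using D(2) D_sub True by (simp add: A'_def)
  next
    case False
    then have i: "i < j" using that by simp
    have eq: "A' i = A i - bad (A i)" using False by (simp add: A'_def)
    have "finite (A i)" using A(1)[OF i] \<open>finite X\<close> finite_subset by blast
    then have le: "card (A' i) \<le> L" using A(2)[OF i] card_mono[of "A i" "A' i"] eq by auto
    have "(1 - \<delta>) * card (A i) \<le> card (A' i)" using card_rest[of i] False i eq by (simp add: B_def)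
    moreover have "\<delta> * card (A i) \<le> \<delta> * L" using \<delta> A(2)[OF i] by (intro mult_left_mono) auto
    moreover have "L * (1 - Suc j / (4 * k)) = L * (1 - j / (4 * k)) - \<delta> * L"
      using kpos by (simp add: \<delta>_def field_simps)
    ultimately have "L * (1 - Suc j / (4 * k)) \<le> card (A' i)"
      using A(3)[OF i] by (simp add: algebra_simps)
    moreover have "uniform (A' i) y" if "y \<in> Y'" for y
      using that uniform_mono[OF _ A(4)[OF i]] by (auto simp: Y'_def eq)
    ultimately show ?thesis using le A(1)[OF i] eq by blast
  qed
  moreover have "uniform_pair (A' i') (A' i)" if "i < Suc j" "i' < i" for i i'
  proof (cases "i = j")
    case True
    have i': "i' < j" "A' i' = A i' - bad (A i')" "A' i = D" using that True by (auto simp: A'_def)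
    \<comment> \<open>One direction is inherited from \<open>D \<subseteq> Y\<close>; the other
      holds because the points of the old part that cross \<open>D\<close> were discarded.\<close>
    show ?thesis unfolding i'(2,3)
    proof (rule uniform_pairI)
      show "uniform (A i' - bad (A i')) v" if "v \<in> D" for v
        using that D_sub(1) uniform_mono[OF _ A(4)[OF i'(1)]] by blast
      show "uniform D u" if "u \<in> A i' - bad (A i')" for u
        using that A(1)[OF i'(1)] A(4)[OF i'(1)] D_sub(1) assms(2)
        by (intro unifD[of u "A i'"]) (auto simp: uniform_def)
    qed
  next
    case False
    then have "uniform_pair (A i') (A i)" using that by (intro A(5)) auto
    moreover have "A' i' \<subseteq> A i'" "A' i \<subseteq> A i" using that False by (auto simp: A'_def)
    ultimately show ?thesis using uniform_pair_mono by blast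
  qed
  ultimately show ?case
    using Y(1) by (intro exI[of _ A'] exI[of _ Y']) (auto simp: Y'_def)
qed

text \<open>With \<open>j = k\<close> each part keeps three quarters of \<open>L\<close>. Since
  \<open>L \<ge> 1\<close>, this gives \<open>L + 1 \<le> 4 * card (A i)\<close>, which absorbs the
  rounding in \<open>L\<close> and turns \<open>4 * k * M\<close> into
  \<open>16 * k * M\<close>.\<close>

lemma ex_uniform_parts:
  fixes k l :: nat
  defines "M \<equiv> (k * l * w + 1) ^ (2 * n) * 3 ^ closure_bound n (2 * n)"
  assumes "X \<subseteq> V" "k \<ge> 1" "16 * k * M \<le> card X"
    and l: "(1 - 1 / (4 * k)) ^ l * real ((card V * w + 1) ^ (2 * n) * card V) < 1"
  shows "\<exists>A. (\<forall>i<k. A i \<subseteq> X \<and> card X \<le> 16 * k * M * card (A i)) \<and>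
    (\<forall>i<k. \<forall>i'<i. uniform_pair (A i') (A i))"
proof -
  \<comment> \<open>\<open>Q\<close> dominates both \<open>2 * M\<close> and \<open>4 * k\<close>,
    the two factors by which \<open>L\<close> must be smaller than \<open>card X\<close>.\<close>
  define Q where "Q = 4 * k * M"
  define L where "L = card X div Q"
  have "M \<ge> 1" by (simp add: M_def)
  have "Q > 0" using \<open>M \<ge> 1\<close> assms(3) by (simp add: Q_def)
  have "Q * L \<le> card X" by (simp add: L_def)
  have "2 * M \<le> Q" "4 * k \<le> Q"
    using mult_le_mono1[of 2 "4 * k" M] mult_le_mono2[OF \<open>M \<ge> 1\<close>, of "4 * k"] assms(3)
    by (auto simp: Q_def)
  then have L: "2 * M * L \<le> card X" "4 * k * L \<le> card X"
    using \<open>Q * L \<le> card X\<close> by (meson mult_le_mono1 order_trans)+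
  have "card X < Q * (L + 1)"
    using \<open>Q > 0\<close> unfolding L_def by (metis Suc_eq_plus1 dividend_less_times_div mult_Suc_right add.commute)
  have "L \<ge> 1" using assms(4) \<open>Q > 0\<close> by (simp add: L_def Q_def Suc_le_eq div_greater_zero_iff)
  obtain A where A: "\<And>i. i < k \<Longrightarrow> A i \<subseteq> X \<and> L * (1 - k / (4 * k)) \<le> card (A i)"
    "\<And>i i'. i < k \<Longrightarrow> i' < i \<Longrightarrow> uniform_pair (A i') (A i)"
    using ex_uniform_parts_upto[OF assms(2,3) l, of L k] L unfolding M_def
    by (metis (no_types, lifting) order_refl)
  have "card X \<le> 16 * k * M * card (A i)" if "i < k" for i
  proof -
    have "3 * real L \<le> 4 * card (A i)" using A(1)[OF that] assms(3) by (simp add: field_simps)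
    then have "L + 1 \<le> 4 * card (A i)" using \<open>L \<ge> 1\<close> by linarith
    then have "Q * (L + 1) \<le> Q * (4 * card (A i))" by (rule mult_le_mono2)
    then show ?thesis using \<open>card X < Q * (L + 1)\<close> by (simp add: Q_def)
  qed
  then show ?thesis using A by blast
qed

text \<open>Among more than \<open>m ^ r\<close> parts, two contain structures with the same list of \<open>r\<close> colors; their
  union uses only one further color.\<close>

lemma ex_few_colors:
  fixes k l R :: nat
  defines "\<Lambda> \<equiv> 16 * k * ((k * l * w + 1) ^ (2 * n) * 3 ^ closure_bound n (2 * n))"
  assumes l: "(1 - 1 / (4 * k)) ^ l * real ((card V * w + 1) ^ (2 * n) * card V) < 1"
    and "m ^ R < k" "m \<ge> 1"
    and "r \<le> R" "X \<subseteq> V" "\<Lambda> ^ r \<le> card X"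
  shows "\<exists>S cs. S \<subseteq> X \<and> card S = 2 ^ r \<and> length cs = r \<and> set cs \<subseteq> {..<m} \<and>
    (\<forall>u\<in>S. \<forall>v\<in>S. u \<noteq> v \<longrightarrow> col u v \<in> set cs)"
  using assms(5-7)
proof (induction r arbitrary: X)
  case 0
  then obtain x where "x \<in> X" by fastforce
  then show ?case by (intro exI[of _ "{x}"] exI[of _ "[]"]) simp
next
  case (Suc r)
  have "k \<ge> 1" using assms(3) by simp
  have "\<Lambda> \<ge> 1" using \<open>k \<ge> 1\<close> by (simp add: \<Lambda>_def)
  then have "\<Lambda> * 1 \<le> \<Lambda> * \<Lambda> ^ r" by (intro mult_le_mono2) simp
  then have "\<Lambda> \<le> card X" using Suc.prems(3) unfolding power_Suc by linarith
  \<comment> \<open>The condition on \<open>l\<close> refers to the whole of \<open>V\<close>, so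
    the same \<open>k\<close> and \<open>l\<close> serve on every level of the recursion.\<close>
  then have "\<exists>A. (\<forall>i<k. A i \<subseteq> X \<and> card X \<le> \<Lambda> * card (A i)) \<and>
      (\<forall>i<k. \<forall>i'<i. uniform_pair (A i') (A i))"
    unfolding \<Lambda>_def by (intro ex_uniform_parts[OF Suc.prems(2) \<open>k \<ge> 1\<close> _ l])
  then obtain A where "\<forall>i<k. A i \<subseteq> X \<and> card X \<le> \<Lambda> * card (A i)"
    and "\<forall>i<k. \<forall>i'<i. uniform_pair (A i') (A i)" by (elim exE conjE)
  then have A: "\<And>i. i < k \<Longrightarrow> A i \<subseteq> X" "\<And>i. i < k \<Longrightarrow> card X \<le> \<Lambda> * card (A i)"
    "\<And>i i'. i < k \<Longrightarrow> i' < i \<Longrightarrow> uniform_pair (A i') (A i)" by simp_all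
  define P where "P i S cs \<longleftrightarrow> S \<subseteq> A i \<and> card S = 2 ^ r \<and> length cs = r \<and>
      set cs \<subseteq> {..<m} \<and> (\<forall>u\<in>S. \<forall>v\<in>S. u \<noteq> v \<longrightarrow> col u v \<in> set cs)"
    for i S and cs :: "nat list"
  have "\<exists>S cs. P i S cs" if "i < k" for i
    unfolding P_def
  proof (rule Suc.IH)
    show "r \<le> R" using Suc.prems(1) by simp
    show "A i \<subseteq> V" using A(1)[OF that] Suc.prems(2) by (rule subset_trans)
    have "\<Lambda> * \<Lambda> ^ r \<le> \<Lambda> * card (A i)"
      using A(2)[OF that] Suc.prems(3) unfolding power_Suc by linarith
    then show "\<Lambda> ^ r \<le> card (A i)" using \<open>\<Lambda> \<ge> 1\<close> by simp
  qed
  then obtain S cs where P: "P i (S i) (cs i)" if "i < k" for i by metis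
  have S: "S i \<subseteq> A i" "card (S i) = 2 ^ r" if "i < k" for i
    using P[OF that] by (auto simp: P_def)
  have cs: "length (cs i) = r" "set (cs i) \<subseteq> {..<m}"
      "\<And>u v. u \<in> S i \<Longrightarrow> v \<in> S i \<Longrightarrow> u \<noteq> v \<Longrightarrow> col u v \<in> set (cs i)" if "i < k" for i
    using P[OF that] by (auto simp: P_def)
  \<comment> \<open>Lists of fixed length are counted by \<open>m ^ r\<close>, which is below
    \<open>k\<close> for every \<open>r \<le> R\<close>.\<close>
  have "cs ` {..<k} \<subseteq> {xs. set xs \<subseteq> {..<m} \<and> length xs = r}" using cs by auto
  then have "card (cs ` {..<k}) \<le> m ^ r"
    using card_mono[OF finite_lists_length_eq[of "{..<m}" r]] card_lists_length_eq[of "{..<m}" r] by simp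
  also have "\<dots> \<le> m ^ R" using Suc.prems(1) assms(4) by (intro power_increasing) auto
  finally have "\<not> inj_on cs {..<k}" using assms(3) by (intro pigeonhole) simp
  then obtain i0 i1 where "i0 < k" "i1 < k" "i0 \<noteq> i1" "cs i0 = cs i1" by (auto simp: inj_on_def)
  then obtain i i' where i: "i < k" "i' < i" "cs i = cs i'"
    by (metis linorder_neqE_nat)
  have "i' < k" using i by simp
  obtain c where c: "\<And>u v. u \<in> A i' \<Longrightarrow> v \<in> A i \<Longrightarrow> col u v = c" and disj: "A i' \<inter> A i = {}"
    using A(3)[OF i(1,2)] unfolding uniform_pair_def by blast
  have ne: "S i \<noteq> {}" "S i' \<noteq> {}" using S(2)[OF i(1)] S(2)[OF \<open>i' < k\<close>] by auto
  then obtain u v where uv: "u \<in> S i'" "v \<in> S i" by blast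
  have SA: "S i \<subseteq> A i" "S i' \<subseteq> A i'" "S i \<subseteq> X" "S i' \<subseteq> X"
    using S(1) A(1) i(1) \<open>i' < k\<close> by (meson order_trans)+
  have "u \<noteq> v" using uv SA disj by blast
  then have "c < m" using col_less[of u v] c[of u v] uv SA Suc.prems(2) by blast
  have fin: "finite (S i)" "finite (S i')"
    using SA Suc.prems(2) finite_V by (meson finite_subset)+
  have "card (S i \<union> S i') = 2 ^ Suc r"
    using S(2) i(1) \<open>i' < k\<close> SA disj fin by (subst card_Un_disjoint) auto
  moreover have "col u v \<in> set (c # cs i)" if mem: "u \<in> S i \<union> S i'" "v \<in> S i \<union> S i'" and "u \<noteq> v" for u v
  proof -
    consider "u \<in> S i" "v \<in> S i" | "u \<in> S i'" "v \<in> S i'" | "u \<in> S i'" "v \<in> S i" |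
      "u \<in> S i" "v \<in> S i'" using mem by blast
    then show ?thesis
    proof cases
      case 1
      then show ?thesis using cs(3)[OF i(1)] \<open>u \<noteq> v\<close> by simp
    next
      case 2
      then show ?thesis using cs(3)[OF \<open>i' < k\<close>] \<open>u \<noteq> v\<close> i(3) by simp
    next
      case 3
      then show ?thesis using c SA by auto
    next
      case 4
      then show ?thesis using c[of v u] SA col_sym by auto
    qed
  qed
  ultimately show ?case
    using SA cs(1,2)[OF i(1)] \<open>c < m\<close>
    by (intro exI[of _ "S i \<union> S i'"] exI[of _ "c # cs i"]) auto
qed

end

subsection \<open>Linearization of semi-algebraic relations\<close>

text \<open>Extending the product to all variables adds only factors with exponent 0; the product
  can then be split into its \<open>u\<close> and \<open>v\<close> parts.\<close>

lemma mvpoly_eval_eq_UNIV: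
  fixes g :: "('x::finite, 'a::comm_semiring_1) mvpoly"
  shows "mvpoly_eval g f =
    (\<Sum>mo\<in>Poly_Mapping.keys g. Poly_Mapping.lookup g mo * (\<Prod>x\<in>UNIV. f x ^ Poly_Mapping.lookup mo x))"
  unfolding mvpoly_eval_def
  by (intro sum.cong refl arg_cong2[of _ _ _ _ "(*)"] prod.mono_neutral_left)
     (auto simp: in_keys_iff)

lemma exponent_le_mvpoly_degree:
  assumes "mo \<in> Poly_Mapping.keys g"
  shows "Poly_Mapping.lookup mo x \<le> mvpoly_degree g"
proof (cases "x \<in> Poly_Mapping.keys mo")
  case True
  then have "Poly_Mapping.lookup mo x \<le> (\<Sum>x\<in>Poly_Mapping.keys mo. Poly_Mapping.lookup mo x)"
    by (intro member_le_sum) auto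
  also have "\<dots> \<le> mvpoly_degree g"
    unfolding mvpoly_degree_def using assms by (intro Max_ge) auto
  finally show ?thesis .
qed (simp add: in_keys_iff)

lemma prod_UNIV_sum:
  "(\<Prod>x\<in>UNIV. h x) = (\<Prod>i\<in>UNIV. h (Inl i)) * (\<Prod>i\<in>UNIV. h (Inr i))"
  for h :: "'a::finite + 'b::finite \<Rightarrow> 'c::comm_monoid_mult"
  by (simp add: UNIV_Plus_UNIV[symmetric] prod.Plus del: UNIV_Plus_UNIV)

text \<open>Each monomial factors into a \<open>u\<close> part and a \<open>v\<close> part. The
  \<open>u\<close> parts with all exponents at most \<open>t\<close> serve as the coordinates
  \<open>\<phi>\<close>; the coefficients and \<open>v\<close> parts form the functional. So
  \<open>n\<close> and \<open>\<phi>\<close> are chosen before the polynomial and the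
  points.\<close>

lemma ex_linearization:
  "\<exists>n (\<phi> :: nat \<Rightarrow> real ^ 'd \<Rightarrow> real) a. \<forall>(g :: ('d + 'd, real) mvpoly) v u.
    mvpoly_degree g \<le> t \<longrightarrow> mvpoly_eval g (case_sum (($) u) (($) v)) = lin \<phi> n (a g v) u"
proof -
  define I where "I = (UNIV :: 'd set) \<rightarrow>\<^sub>E {..t}"
  have "finite I" by (simp add: I_def finite_PiE)
  obtain en where en: "bij_betw en {..<card I} I"
    using ex_bij_betw_nat_finite[OF \<open>finite I\<close>] by (auto simp: atLeast0LessThan)
  define \<phi> :: "nat \<Rightarrow> real ^ 'd \<Rightarrow> real" where "\<phi> j u = (\<Prod>i\<in>UNIV. u $ i ^ en j i)" for j u
  define \<pi> where "\<pi> mo = (\<lambda>i :: 'd. Poly_Mapping.lookup mo (Inl i :: 'd + 'd) :: nat)" for mo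
  define b where "b g v mo = Poly_Mapping.lookup g mo * (\<Prod>i\<in>UNIV. v $ i ^ Poly_Mapping.lookup mo (Inr i))"
    for g :: "('d + 'd, real) mvpoly" and v :: "real ^ 'd" and mo
  define F where "F g v e = (\<Sum>mo\<in>{mo \<in> Poly_Mapping.keys g. \<pi> mo = e}. b g v mo)" for g v e
  have "mvpoly_eval g (case_sum (($) u) (($) v)) = lin \<phi> (card I) (\<lambda>j. F g v (en j)) u"
    if deg: "mvpoly_degree g \<le> t" for g :: "('d + 'd, real) mvpoly" and u v :: "real ^ 'd"
  proof -
    have \<pi>: "\<pi> ` Poly_Mapping.keys g \<subseteq> I"
      using order.trans[OF exponent_le_mvpoly_degree[of _ g] deg]
      by (auto simp: I_def \<pi>_def PiE_UNIV_domain)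
    have "mvpoly_eval g (case_sum (($) u) (($) v)) =
        (\<Sum>mo\<in>Poly_Mapping.keys g. b g v mo * (\<Prod>i\<in>UNIV. u $ i ^ \<pi> mo i))"
      unfolding mvpoly_eval_eq_UNIV prod_UNIV_sum by (simp add: b_def \<pi>_def mult_ac)
    \<comment> \<open>Monomials with the same exponents in \<open>u\<close> are grouped
      together.\<close>
    also have "\<dots> = (\<Sum>e\<in>I. \<Sum>mo\<in>{mo \<in> Poly_Mapping.keys g. \<pi> mo = e}.
        b g v mo * (\<Prod>i\<in>UNIV. u $ i ^ \<pi> mo i))"
      by (intro sum.group[symmetric] \<pi> \<open>finite I\<close> finite_keys)
    also have "\<dots> = (\<Sum>e\<in>I. F g v e * (\<Prod>i\<in>UNIV. u $ i ^ e i))"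
      by (intro sum.cong refl) (simp add: F_def sum_distrib_right)
    also have "\<dots> = (\<Sum>j<card I. F g v (en j) * \<phi> j u)"
      unfolding \<phi>_def by (rule sum.reindex_bij_betw[OF en, symmetric])
    finally show ?thesis by (simp add: lin_def)
  qed
  then show ?thesis
    by (intro exI[of _ "card I"] exI[of _ \<phi>] exI[of _ "\<lambda>g v j. F g v (en j)"]) simp
qed

lemma bool_formula_eval_cong:
  "(\<And>i. i \<in> set_bool_formula \<Phi> \<Longrightarrow> f i = h i) \<Longrightarrow> bool_formula_eval f \<Phi> = bool_formula_eval h \<Phi>"
  by (induction \<Phi>) auto

text \<open>If \<open>V\<close> were larger, \<open>ex_few_colors\<close> would give
  \<open>2 ^ R\<close> points spanning at most \<open>R\<close> colors, and any \<open>p\<close> of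
  them would violate the coloring condition.\<close>

lemma pq_coloring_card_less:
  fixes V :: "(real ^ 'd) set" and \<phi> :: "nat \<Rightarrow> real ^ 'd \<Rightarrow> real"
  assumes a: "\<And>(g :: ('d + 'd, real) mvpoly) v u. mvpoly_degree g \<le> t \<Longrightarrow>
      mvpoly_eval g (case_sum (($) u) (($) v)) = lin \<phi> n (a g v) u"
    and "finite V" and pq: "pq_coloring V p (R + 1) m E"
    and sa: "\<And>k. k < m \<Longrightarrow> semialg_relation V t (E k)"
    and l: "(1 - 1 / real (4 * k)) ^ l * real ((card V * (m * t) + 1) ^ (2 * n) * card V) < 1"
    and "m ^ R < k" "m \<ge> 1" "p \<le> 2 ^ R"
  shows "card V < (16 * k * ((k * l * (m * t) + 1) ^ (2 * n) * 3 ^ closure_bound n (2 * n))) ^ R"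
proof (rule ccontr)
  assume large: "\<not> ?thesis"
  \<comment> \<open>Disjointness of the classes makes the color of an edge unique. Elsewhere the
    value is arbitrary, but still symmetric because it depends only on
    \<open>{u, v}\<close>.\<close>
  define col where "col u v = (THE c. c < m \<and> {u, v} \<in> E c)" for u v
  have UN: "(\<Union>c<m. E c) = [V]\<^bsup>2\<^esup>" and disj: "disjoint_family_on E {..<m}"
    and many: "\<And>S. S \<in> [V]\<^bsup>p\<^esup> \<Longrightarrow> R + 1 \<le> card {c \<in> {..<m}. E c \<inter> [S]\<^bsup>2\<^esup> \<noteq> {}}"
    using pq by (auto simp: pq_coloring_def)
  have col_unique: "c = col u v" if "c < m" "{u, v} \<in> E c" for c u v
  proof -
    have uniq: "c' = c" if "c' < m" "{u, v} \<in> E c'" for c'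
      using disj \<open>c < m\<close> \<open>{u, v} \<in> E c\<close> that unfolding disjoint_family_on_def by blast
    show ?thesis unfolding col_def
      using that uniq by (intro the_equality[symmetric] conjI) (assumption | erule conjE)+
  qed
  have col: "col u v < m" "{u, v} \<in> E (col u v)" if "u \<in> V" "v \<in> V" "u \<noteq> v" for u v
  proof -
    have "{u, v} \<in> (\<Union>c<m. E c)" using that UN by simp
    then obtain c where "c < m" "{u, v} \<in> E c" by blast
    then show "col u v < m" "{u, v} \<in> E (col u v)" using col_unique by auto
  qed
  define Q where "Q c gs \<Phi> \<longleftrightarrow> length gs \<le> t \<and> (\<forall>g\<in>set gs. mvpoly_degree g \<le> t) \<and>
      set_bool_formula \<Phi> \<subseteq> {..<length gs} \<and>
      (\<forall>u\<in>V. \<forall>v\<in>V. u \<noteq> v \<longrightarrow> ({u, v} \<in> E c \<longleftrightarrow> semialg_holds \<Phi> gs u v))" for c gs \<Phi>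
  have "\<exists>gs \<Phi>. Q c gs \<Phi>" if "c < m" for c
    using sa[OF that] unfolding semialg_relation_def Q_def by blast
  then obtain gs \<Phi> where Q: "Q c (gs c) (\<Phi> c)" if "c < m" for c by metis
  have gs: "length (gs c) \<le> t" "\<And>g. g \<in> set (gs c) \<Longrightarrow> mvpoly_degree g \<le> t"
    and \<Phi>: "set_bool_formula (\<Phi> c) \<subseteq> {..<length (gs c)}"
      "\<And>u v. u \<in> V \<Longrightarrow> v \<in> V \<Longrightarrow> u \<noteq> v \<Longrightarrow> {u, v} \<in> E c \<longleftrightarrow> semialg_holds (\<Phi> c) (gs c) u v"
    if "c < m" for c
    using Q[OF that] by (simp_all add: Q_def)
  define P where "P = (SIGMA c:{..<m}. {..<length (gs c)})"
  define H where "H v = (\<lambda>(c, i). a (gs c ! i) v) ` P" for v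
  have "finite P" by (simp add: P_def)
  have "card P = (\<Sum>c<m. length (gs c))" by (simp add: P_def)
  also have "\<dots> \<le> m * t" using gs(1) sum_bounded_above[of "{..<m}" "\<lambda>c. length (gs c)" t] by simp
  finally have card_H: "card (H v) \<le> m * t" for v
    unfolding H_def using card_image_le[OF \<open>finite P\<close>] order.trans by blast
  interpret sign_coloring V col m \<phi> n H "m * t"
  proof
    show "finite V" by fact
    show "col u v = col v u" for u v by (simp add: col_def insert_commute)
    show "u \<in> V \<Longrightarrow> v \<in> V \<Longrightarrow> u \<noteq> v \<Longrightarrow> col u v < m" for u v by (rule col)
    show "finite (H v) \<and> card (H v) \<le> m * t" for v
      using card_H \<open>finite P\<close> by (simp add: H_def)
    fix u u' v assume V: "u \<in> V" "u' \<in> V" "v \<in> V" and "u \<noteq> v" "u' \<noteq> v"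
      and sgn: "\<And>b. b \<in> H v \<Longrightarrow> sgn (lin \<phi> n b u) = sgn (lin \<phi> n b u')"
    \<comment> \<open>It suffices to test the formula of the color of \<open>uv\<close>: it holds at
      \<open>(u, v)\<close>, and equal signs carry it over to \<open>(u', v)\<close>.\<close>
    define c where "c = col u v"
    have c: "c < m" "{u, v} \<in> E c" using col[of u v] V \<open>u \<noteq> v\<close> by (auto simp: c_def)
    have "semialg_holds (\<Phi> c) (gs c) u v = semialg_holds (\<Phi> c) (gs c) u' v"
      unfolding semialg_holds_def
    proof (rule bool_formula_eval_cong)
      fix i assume "i \<in> set_bool_formula (\<Phi> c)"
      then have i: "i < length (gs c)" using \<Phi>(1)[OF c(1)] by blast
      then have "a (gs c ! i) v \<in> H v" unfolding H_def P_def using c(1) by force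
      then have "sgn (lin \<phi> n (a (gs c ! i) v) u) = sgn (lin \<phi> n (a (gs c ! i) v) u')" by (rule sgn)
      moreover have "mvpoly_degree (gs c ! i) \<le> t" using gs(2)[OF c(1)] i by simp
      ultimately show "(0 \<le> mvpoly_eval (gs c ! i) (case_sum (($) u) (($) v))) =
          (0 \<le> mvpoly_eval (gs c ! i) (case_sum (($) u') (($) v)))"
        by (metis a zero_le_sgn_iff)
    qed
    then have "{u', v} \<in> E c" using \<Phi>(2)[OF c(1)] V \<open>u \<noteq> v\<close> \<open>u' \<noteq> v\<close> c(2) by blast
    then show "col u v = col u' v" using col_unique[OF c(1)] c_def by blast
  qed
  obtain S cs where S: "S \<subseteq> V" "card S = 2 ^ R" "length cs = R"
    "\<And>u v. u \<in> S \<Longrightarrow> v \<in> S \<Longrightarrow> u \<noteq> v \<Longrightarrow> col u v \<in> set cs"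
    using ex_few_colors[OF l \<open>m ^ R < k\<close> \<open>m \<ge> 1\<close> order_refl order_refl] large by (metis not_less)
  obtain T where T: "T \<subseteq> S" "card T = p" "finite T"
    using obtain_subset_with_card_n[of p S] S(2) \<open>p \<le> 2 ^ R\<close> by auto
  have "T \<in> [V]\<^bsup>p\<^esup>" using T S(1) by (auto simp: nsets_def)
  have "{c \<in> {..<m}. E c \<inter> [T]\<^bsup>2\<^esup> \<noteq> {}} \<subseteq> set cs"
  proof
    fix c assume "c \<in> {c \<in> {..<m}. E c \<inter> [T]\<^bsup>2\<^esup> \<noteq> {}}"
    then obtain e where e: "c < m" "e \<in> E c" "e \<in> [T]\<^bsup>2\<^esup>" by blast
    then obtain u v where "u \<in> T" "v \<in> T" "u \<noteq> v" "e = {u, v}" by (auto simp: nsets_2_eq)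
    then show "c \<in> set cs" using e col_unique[of c u v] S(4)[of u v] T(1) by auto
  qed
  then have "card {c \<in> {..<m}. E c \<inter> [T]\<^bsup>2\<^esup> \<noteq> {}} \<le> card (set cs)" by (intro card_mono) auto
  also have "\<dots> \<le> R" using card_length[of cs] S(3) by simp
  finally show False using many[OF \<open>T \<in> _\<close>] by simp
qed

subsection \<open>Lower bound\<close>

text \<open>With \<open>\<mu> = N powr a\<close>, every factor is bounded by a power of
  \<open>\<mu>\<close>: \<open>k\<close> by exponent \<open>R + 1\<close>, \<open>l\<close> by
  \<open>R + 2\<close>, \<open>m * t\<close> by 2. The final expression is at most
  \<open>\<mu> ^ (E * R ^ 2)\<close>, which equals \<open>N\<close> by the choice of
  \<open>a\<close>.\<close>

lemma eventually_parameters: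
  fixes n t R :: nat
  assumes "t \<ge> 1" "R \<ge> 1"
  defines "a \<equiv> 1 / (real (16 * n + 4) * real R ^ 2)"
  shows "\<forall>\<^sub>F N in sequentially. \<forall>m\<ge>1. real m < real N powr a \<longrightarrow>
    (\<exists>k l. m ^ R < k \<and> (1 - 1 / real (4 * k)) ^ l * real ((N * (m * t) + 1) ^ (2 * n) * N) < 1 \<and>
      (16 * k * ((k * l * (m * t) + 1) ^ (2 * n) * 3 ^ closure_bound n (2 * n))) ^ R \<le> N)"
proof -
  define G where "G = closure_bound n (2 * n)"
  define base where "base N = real N ^ 2 * real t + real N + 1" for N
  define E where "E = 16 * n + 4"
  have "a > 0" using assms(2) by (simp add: a_def)
  have "real t > 0" using assms(1) by simp
  \<comment> \<open>Chosen so that \<open>k * (c * ln (base N) + 5)\<close> bounds \<open>l\<close>,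
    with \<open>5 = 4 + 1\<close>: the 4 comes from the slack in \<open>l\<close>, the 1 from
    rounding up.\<close>
  define c where "c = 4 * (2 * real n + 1)"
  have "c > 0" by (simp add: c_def add_pos_nonneg)
  have "\<forall>\<^sub>F N in sequentially. c * ln (real N ^ 2 * real t + real N + 1) + 5 \<le> real N powr a"
    using \<open>a > 0\<close> \<open>real t > 0\<close> \<open>c > 0\<close> by real_asymp
  moreover have "\<forall>\<^sub>F N in sequentially. max 16 (max (real t) (3 ^ G)) \<le> real N powr a"
    using \<open>a > 0\<close> by real_asymp
  ultimately show ?thesis
    using eventually_ge_at_top[of 1]
  proof eventually_elim
    case (elim N)
    define \<mu> where "\<mu> = real N powr a"
    have \<mu>: "16 \<le> \<mu>" "real t \<le> \<mu>" "3 ^ G \<le> \<mu>" "c * ln (base N) + 5 \<le> \<mu>"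
      using elim(1,2) by (simp_all add: \<mu>_def base_def)
    show ?case
    proof (intro allI impI)
      fix m :: nat assume m: "m \<ge> 1" "real m < real N powr a"
      then have "real m < \<mu>" by (simp add: \<mu>_def)
      have "1 \<le> (16 * n + 4) * R ^ 2" using assms(2) by simp
      then have "1 \<le> real ((16 * n + 4) * R ^ 2)" by linarith
      then have "a \<le> 1" by (simp add: a_def)
      then have "\<mu> \<le> real N powr 1" unfolding \<mu>_def using elim(3) by (intro powr_mono) auto
      then have "m \<le> N" using \<open>real m < \<mu>\<close> by simp
      define k where "k = m ^ R + 1"
      \<comment> \<open>By \<open>1 - x \<le> exp (- x)\<close>, the power is at most
        \<open>exp (- l / (4 * k))\<close>. This beats the count
        \<open>base N ^ (2 * n + 1)\<close>, and the extra 1 leaves a factor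
        \<open>exp (- 1)\<close>, below 1.\<close>
      define l where "l = nat \<lceil>4 * real k * ((2 * n + 1) * ln (base N) + 1)\<rceil>"
      have "base N \<ge> 1" by (simp add: base_def)
      have "real k > 0" unfolding k_def by linarith
      define F where "F = real ((N * (m * t) + 1) ^ (2 * n) * N)"
      have "F \<le> base N ^ (2 * n) * base N"
      proof -
        have "real N * (real m * real t) \<le> real N * (real N * real t)"
          using \<open>m \<le> N\<close> by (intro mult_left_mono mult_right_mono) auto
        then have "real N * (real m * real t) + 1 \<le> base N" by (simp add: base_def power2_eq_square)
        then show ?thesis
          unfolding F_def of_nat_mult of_nat_power of_nat_add of_nat_1
          by (intro mult_mono power_mono) (auto simp: base_def)
      qed
      then have F: "F \<le> exp ((2 * n + 1) * ln (base N))"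
        using \<open>base N \<ge> 1\<close> exp_of_nat_mult[of "2 * n + 1" "ln (base N)"] by (simp add: mult.commute)
      have l_ge: "4 * real k * ((2 * n + 1) * ln (base N) + 1) \<le> real l"
        unfolding l_def by (rule real_nat_ceiling_ge)
      have "(1 - 1 / real (4 * k)) ^ l \<le> exp (- 1 / real (4 * k)) ^ l"
        using exp_ge_add_one_self[of "- 1 / real (4 * k)"] \<open>real k > 0\<close>
        by (intro power_mono) (auto simp: field_simps k_def)
      also have "\<dots> = exp (- (l / (4 * k)))" by (simp add: exp_of_nat_mult[symmetric])
      also have "\<dots> \<le> exp (- ((2 * n + 1) * ln (base N) + 1))"
        using l_ge \<open>real k > 0\<close> by (simp add: field_simps)
      finally have "(1 - 1 / real (4 * k)) ^ l * F \<le>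
          exp (- ((2 * n + 1) * ln (base N) + 1)) * exp ((2 * n + 1) * ln (base N))"
        using F by (intro mult_mono) (auto simp: F_def)
      also have "\<dots> = exp (- 1)" by (simp add: exp_add[symmetric])
      also have "\<dots> < 1" by simp
      finally have cond: "(1 - 1 / real (4 * k)) ^ l * F < 1" .
      have pos: "1 \<le> \<mu>" "0 \<le> \<mu>" using \<mu>(1) by auto
      \<comment> \<open>A constant or logarithmic factor that is at most \<open>\<mu>\<close> costs
        one more power of \<open>\<mu>\<close>.\<close>
      have absorb: "x * y \<le> \<mu> ^ Suc j" if "x \<le> \<mu>" "y \<le> \<mu> ^ j" "0 \<le> x" "0 \<le> y" for x y j
        unfolding power_Suc using that by (intro mult_mono) auto
      have "real (m ^ R) \<le> \<mu> ^ R"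
        unfolding of_nat_power using \<open>real m < \<mu>\<close> by (intro power_mono) auto
      then have "real k \<le> 2 * \<mu> ^ R" using one_le_power[OF pos(1), of R] by (simp add: k_def)
      also have "\<dots> \<le> \<mu> ^ (R + 1)" using absorb[of 2 "\<mu> ^ R" R] \<mu>(1) by simp
      finally have k_le: "real k \<le> \<mu> ^ (R + 1)" .
      have l_le: "real l \<le> \<mu> ^ (R + 2)"
      proof -
        have "ln (base N) \<ge> 0" using \<open>base N \<ge> 1\<close> by simp
        then have "0 \<le> 4 * real k * ((2 * n + 1) * ln (base N) + 1)" by simp
        then have "real l \<le> 4 * real k * ((2 * n + 1) * ln (base N) + 1) + 1"
          unfolding l_def by linarith
        also have "\<dots> \<le> 4 * real k * ((2 * n + 1) * ln (base N) + 1) + real k"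
          by (simp add: k_def)
        also have "\<dots> = real k * (c * ln (base N) + 5)" by (simp add: c_def algebra_simps)
        also have "\<dots> \<le> \<mu> * \<mu> ^ (R + 1)"
          using k_le \<mu>(4) pos by (subst mult.commute, intro mult_mono) auto
        finally show ?thesis by simp
      qed
      have w_le: "real (m * t) \<le> \<mu> ^ 2"
        unfolding of_nat_mult power2_eq_square
        using \<open>real m < \<mu>\<close> \<mu>(2) by (intro mult_mono) auto
      have "real (k * l * (m * t)) \<le> \<mu> ^ (R + 1) * \<mu> ^ (R + 2) * \<mu> ^ 2"
        using k_le l_le w_le pos unfolding of_nat_mult by (intro mult_mono) auto
      also have "\<dots> = \<mu> ^ (2 * R + 5)"
        unfolding power_add[symmetric] by (intro arg_cong[of _ _ "(^) \<mu>"]) simp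
      finally have "real (k * l * (m * t) + 1) \<le> \<mu> ^ (2 * R + 5) + \<mu> ^ (2 * R + 5)"
        using one_le_power[OF pos(1), of "2 * R + 5"] by simp
      also have "\<dots> \<le> \<mu> ^ Suc (2 * R + 5)"
        using absorb[of 2 "\<mu> ^ (2 * R + 5)" "2 * R + 5"] \<mu>(1) pos by (simp del: power_Suc)
      also have "Suc (2 * R + 5) = 2 * R + 6" by simp
      finally have "real (k * l * (m * t) + 1) ^ (2 * n) \<le> (\<mu> ^ (2 * R + 6)) ^ (2 * n)"
        by (rule power_mono) simp
      then have "real (16 * k * ((k * l * (m * t) + 1) ^ (2 * n) * 3 ^ G))
          \<le> \<mu> * \<mu> ^ (R + 1) * ((\<mu> ^ (2 * R + 6)) ^ (2 * n) * \<mu>)"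
        unfolding of_nat_mult of_nat_power of_nat_numeral
        using k_le \<mu>(1,3) pos by (intro mult_mono) auto
      also have "\<dots> = \<mu> ^ ((2 * R + 6) * (2 * n) + R + 3)"
        by (simp add: power_add power_mult power3_eq_cube)
      \<comment> \<open>For \<open>R \<ge> 1\<close>, \<open>2 * R + 6 \<le> 8 * R\<close> and
        \<open>R + 3 \<le> 4 * R\<close>; this is the origin of \<open>16 * n + 4\<close>.\<close>
      also have "\<dots> \<le> \<mu> ^ (E * R)"
      proof (rule power_increasing[OF _ pos(1)])
        have "(2 * R + 6) * (2 * n) \<le> (8 * R) * (2 * n)" using assms(2) by (intro mult_le_mono1) simp
        moreover have "E * R = 8 * R * (2 * n) + 4 * R" by (simp add: E_def algebra_simps)
        ultimately show "(2 * R + 6) * (2 * n) + R + 3 \<le> E * R" using assms(2) by linarith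
      qed
      finally have "real (16 * k * ((k * l * (m * t) + 1) ^ (2 * n) * 3 ^ G)) ^ R \<le> (\<mu> ^ (E * R)) ^ R"
        by (rule power_mono) simp
      also have "\<dots> = \<mu> ^ (E * R ^ 2)"
        by (simp add: power2_eq_square mult.assoc flip: power_mult)
      also have "\<dots> = \<mu> powr real (E * R ^ 2)"
        using \<mu>(1) by (intro powr_realpow[symmetric]) simp
      also have "\<dots> = real N"
        using assms(2) elim(3) unfolding \<mu>_def powr_powr a_def E_def[symmetric]
        by (simp add: E_def)
      finally have "(16 * k * ((k * l * (m * t) + 1) ^ (2 * n) * 3 ^ G)) ^ R \<le> N"
        by (simp only: of_nat_power[symmetric] of_nat_le_iff)
      moreover have "m ^ R < k" by (simp add: k_def)
      ultimately show "\<exists>k l. m ^ R < k \<and>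
          (1 - 1 / real (4 * k)) ^ l * real ((N * (m * t) + 1) ^ (2 * n) * N) < 1 \<and>
          (16 * k * ((k * l * (m * t) + 1) ^ (2 * n) * 3 ^ closure_bound n (2 * n))) ^ R \<le> N"
        using cond unfolding F_def G_def by blast
    qed
  qed
qed


text \<open>An infimum in \<open>enat\<close> over a nonempty set is attained, so a bound for each
  coloring suffices; over the empty set it is infinity.\<close>

lemma semialg_ramsey_geI:
  assumes "\<And>(V :: (real ^ 'd::finite) set) E m. finite V \<Longrightarrow> card V = n \<Longrightarrow> pq_coloring V p q m E \<Longrightarrow>
      (\<And>k. k < m \<Longrightarrow> semialg_relation V t (E k)) \<Longrightarrow> x \<le> real m"
  shows "ereal x \<le> ereal_of_enat (semialg_ramsey TYPE('d) t n p q)"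
proof -
  define A where "A = {enat m | m. \<exists>(V :: (real ^ 'd) set) E. finite V \<and> card V = n \<and>
      pq_coloring V p q m E \<and> (\<forall>k<m. semialg_relation V t (E k))}"
  have A: "semialg_ramsey TYPE('d) t n p q = Inf A" by (simp add: semialg_ramsey_def A_def)
  show ?thesis
  proof (cases "A = {}")
    case True
    then show ?thesis by (simp add: A Inf_enat_def)
  next
    case False
    then have "Inf A \<in> A" unfolding Inf_enat_def by (auto intro: LeastI)
    then obtain m where "Inf A = enat m" "x \<le> real m" unfolding A_def using assms by blast
    then show ?thesis by (simp add: A)
  qed
qed

text \<open>\<open>D\<close> depends only on the dimension and \<open>t\<close>, so
  \<open>c = 4 * (16 * D + 4)\<close> serves all \<open>p\<close>. The factor 4 pays for rounding:
  \<open>R \<le> 2 * log 2 p\<close>, since \<open>log 2 p \<ge> 1\<close>.\<close>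

lemma lower_bound:
  fixes t :: nat
  assumes "t \<ge> 1"
  shows "\<exists>c::real. c > 0 \<and> (\<forall>p::nat. p \<ge> 3 \<longrightarrow>
    (\<forall>\<^sub>F n in sequentially.
      ereal_of_enat (semialg_ramsey TYPE('d::finite) t n p (nat \<lceil>log 2 (real p)\<rceil> + 1))
        \<ge> ereal (real n powr (1 / (c * (log 2 (real p))\<^sup>2)))))"
proof -
  obtain D \<phi> a where lin: "\<And>(g :: ('d + 'd, real) mvpoly) v u. mvpoly_degree g \<le> t \<Longrightarrow>
      mvpoly_eval g (case_sum (($) u) (($) v)) = lin \<phi> D (a g v) u"
    using ex_linearization[of t] by blast
  define E where "E = real (16 * D + 4)"
  have "E > 0" by (simp add: E_def)
  have "\<forall>\<^sub>F n in sequentially.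
      ereal_of_enat (semialg_ramsey TYPE('d) t n p (nat \<lceil>log 2 (real p)\<rceil> + 1))
        \<ge> ereal (real n powr (1 / (4 * E * (log 2 (real p))\<^sup>2)))" if "p \<ge> 3" for p :: nat
  proof -
    define R where "R = nat \<lceil>log 2 (real p)\<rceil>"
    have log_p: "log 2 (real p) \<ge> 1" using that by (simp add: le_log_iff)
    then have R: "log 2 (real p) \<le> real R" "real R \<le> 2 * log 2 (real p)" "R \<ge> 1"
      unfolding R_def by linarith+
    have "real p = 2 powr log 2 (real p)" using that by simp
    also have "\<dots> \<le> 2 powr real R" using R(1) by simp
    also have "\<dots> = 2 ^ R" by (simp add: powr_realpow)
    finally have "p \<le> 2 ^ R" by (metis of_nat_le_iff of_nat_numeral of_nat_power)
    show ?thesis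
      using eventually_parameters[OF assms R(3), of D] eventually_ge_at_top[of 2]
    proof eventually_elim
      case (elim n)
      show ?case
      proof (rule semialg_ramsey_geI)
        fix V :: "(real ^ 'd) set" and F m
        assume V: "finite V" "card V = n" and pq: "pq_coloring V p (nat \<lceil>log 2 (real p)\<rceil> + 1) m F"
          and sa: "\<And>k. k < m \<Longrightarrow> semialg_relation V t (F k)"
        have "m \<ge> 1"
        proof (rule ccontr)
          assume "\<not> m \<ge> 1"
          then have "m = 0" by simp
          then have "[V]\<^bsup>2\<^esup> = {}" using pq by (simp add: pq_coloring_def)
          moreover obtain S where "S \<subseteq> V" "card S = 2" "finite S"
            using obtain_subset_with_card_n[of 2 V] V elim(2) by auto
          ultimately show False by (auto simp: nsets_def)
        qed
        have m_ge: "real n powr (1 / (E * real R ^ 2)) \<le> real m"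
        proof (rule ccontr)
          assume "\<not> ?thesis"
          then obtain k l where kl: "m ^ R < k"
            "(1 - 1 / real (4 * k)) ^ l * real ((n * (m * t) + 1) ^ (2 * D) * n) < 1"
            "(16 * k * ((k * l * (m * t) + 1) ^ (2 * D) * 3 ^ closure_bound D (2 * D))) ^ R \<le> n"
            using elim(1) \<open>m \<ge> 1\<close> unfolding E_def by (meson not_le)
          show False
            using pq_coloring_card_less[OF lin V(1) pq[folded R_def] sa _ kl(1) \<open>m \<ge> 1\<close> \<open>p \<le> 2 ^ R\<close>]
              kl(2,3) V(2) by fastforce
        qed
        have "1 / (4 * E * (log 2 (real p))\<^sup>2) \<le> 1 / (E * real R ^ 2)"
        proof (rule divide_left_mono)
          have "real R ^ 2 \<le> (2 * log 2 (real p)) ^ 2" using R(2) by (intro power_mono) auto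
          then have "E * real R ^ 2 \<le> E * (2 * log 2 (real p)) ^ 2"
            using \<open>E > 0\<close> by (intro mult_left_mono) auto
          then show "E * real R ^ 2 \<le> 4 * E * (log 2 (real p))\<^sup>2"
            by (simp add: power_mult_distrib mult_ac)
          show "0 < 4 * E * (log 2 (real p))\<^sup>2 * (E * real R ^ 2)"
            using \<open>E > 0\<close> R(3) log_p by simp
        qed simp
        then have "real n powr (1 / (4 * E * (log 2 (real p))\<^sup>2)) \<le> real n powr (1 / (E * real R ^ 2))"
          using elim(2) by (intro powr_mono) auto
        then show "real n powr (1 / (4 * E * (log 2 (real p))\<^sup>2)) \<le> real m"
          using m_ge by (rule order.trans)
      qed
    qed
  qed
  then show ?thesis using \<open>E > 0\<close> by (intro exI[of _ "4 * E"]) simp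
qed

subsection \<open>Upper bound\<close>

text \<open>Base 3 keeps distances informative. In base 2 the lower digits could cancel the leading
  one almost completely.\<close>

definition ternary :: "nat set \<Rightarrow> int" where
  "ternary B = (\<Sum>i\<in>B. 3 ^ i)"

lemma ternary_bounds: "B \<subseteq> {..<j} \<Longrightarrow> 0 \<le> ternary B \<and> 2 * ternary B < 3 ^ j"
proof -
  assume "B \<subseteq> {..<j}"
  then have "ternary B \<le> (\<Sum>i<j. 3 ^ i)" unfolding ternary_def by (intro sum_mono2) auto
  moreover have "2 * (\<Sum>i<j. 3 ^ i :: int) < 3 ^ j" by (induction j) auto
  ultimately show ?thesis by (auto simp: ternary_def sum_nonneg)
qed

text \<open>Digits above \<open>j\<close> cancel, and those below change the difference by less than
  half of \<open>3 ^ j\<close>.\<close>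

lemma ternary_diff:
  assumes "finite A" "finite B" "j \<in> A" "j \<notin> B" "A \<inter> {j<..} = B \<inter> {j<..}"
  shows "3 ^ j < 2 * (ternary A - ternary B)" "2 * (ternary A - ternary B) < 3 ^ Suc j"
proof -
  have split: "ternary S = ternary (S \<inter> {..<j}) + ternary (S \<inter> {j}) + ternary (S \<inter> {j<..})"
    if "finite S" for S
  proof -
    have "S = (S \<inter> {..<j} \<union> S \<inter> {j}) \<union> S \<inter> {j<..}" by auto
    then have "ternary S = sum (\<lambda>i. 3 ^ i) ((S \<inter> {..<j} \<union> S \<inter> {j}) \<union> S \<inter> {j<..})"
      by (simp add: ternary_def)
    also have "\<dots> = ternary (S \<inter> {..<j}) + ternary (S \<inter> {j}) + ternary (S \<inter> {j<..})"
      unfolding ternary_def using that by (subst sum.union_disjoint; (subst sum.union_disjoint)?) auto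
    finally show ?thesis .
  qed
  have "ternary (A \<inter> {j}) = 3 ^ j" "ternary (B \<inter> {j}) = 0"
    using assms(3,4) by (simp_all add: ternary_def)
  then have "ternary A - ternary B = 3 ^ j + (ternary (A \<inter> {..<j}) - ternary (B \<inter> {..<j}))"
    using split[OF assms(1)] split[OF assms(2)] assms(5) by simp
  then show "3 ^ j < 2 * (ternary A - ternary B)" "2 * (ternary A - ternary B) < 3 ^ Suc j"
    using ternary_bounds[of "A \<inter> {..<j}" j] ternary_bounds[of "B \<inter> {..<j}" j] by auto
qed

text \<open>The color of a pair. For \<open>A = B\<close> it is the maximum of the empty set, hence
  \<open>A \<noteq> B\<close> in the lemmas on its value.\<close>

definition top_diff :: "nat set \<Rightarrow> nat set \<Rightarrow> nat" where
  "top_diff A B = Max ((A - B) \<union> (B - A))"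

lemma top_diff_commute: "top_diff A B = top_diff B A"
  by (simp add: top_diff_def Un_commute)

lemma top_diff:
  assumes "finite A" "finite B" "A \<noteq> B"
  shows "top_diff A B \<in> (A - B) \<union> (B - A)" "A \<inter> {top_diff A B<..} = B \<inter> {top_diff A B<..}"
proof -
  define D where "D = (A - B) \<union> (B - A)"
  have D: "finite D" "D \<noteq> {}" using assms by (auto simp: D_def)
  show "top_diff A B \<in> (A - B) \<union> (B - A)"
    using Max_in[OF D] by (simp add: D_def top_diff_def)
  have "x \<le> top_diff A B" if "x \<in> D" for x
    using Max_ge[OF D(1) that] by (simp add: D_def top_diff_def)
  then show "A \<inter> {top_diff A B<..} = B \<inter> {top_diff A B<..}" by (fastforce simp: D_def)
qed

lemma abs_ternary_diff:
  assumes "finite A" "finite B" "A \<noteq> B"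
  shows "3 ^ top_diff A B < 2 * \<bar>ternary A - ternary B\<bar>"
    "2 * \<bar>ternary A - ternary B\<bar> < 3 ^ Suc (top_diff A B)"
proof -
  note td = top_diff[OF assms]
  have "3 ^ top_diff A B < 2 * \<bar>ternary A - ternary B\<bar> \<and>
    2 * \<bar>ternary A - ternary B\<bar> < 3 ^ Suc (top_diff A B)"
  proof (cases "top_diff A B \<in> A")
    case True
    then show ?thesis using ternary_diff[OF assms(1,2) True] td by auto
  next
    case False
    then have "top_diff A B \<in> B" using td(1) by blast
    then show ?thesis using ternary_diff[OF assms(2,1) _ False td(2)[symmetric]] by auto
  qed
  then show "3 ^ top_diff A B < 2 * \<bar>ternary A - ternary B\<bar>"
    "2 * \<bar>ternary A - ternary B\<bar> < 3 ^ Suc (top_diff A B)" by auto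
qed

text \<open>The distance intervals belonging to different \<open>j\<close> are disjoint, so the
  distance determines the color.\<close>

lemma top_diff_eq_iff:
  assumes "finite A" "finite B" "A \<noteq> B"
  shows "top_diff A B = j \<longleftrightarrow>
    3 ^ j < 2 * \<bar>ternary A - ternary B\<bar> \<and> 2 * \<bar>ternary A - ternary B\<bar> < 3 ^ Suc j"
proof
  assume "3 ^ j < 2 * \<bar>ternary A - ternary B\<bar> \<and> 2 * \<bar>ternary A - ternary B\<bar> < 3 ^ Suc j"
  then have "(3::int) ^ j < 3 ^ Suc (top_diff A B)" "(3::int) ^ top_diff A B < 3 ^ Suc j"
    using abs_ternary_diff[OF assms] by linarith+
  then have "j < Suc (top_diff A B)" "top_diff A B < Suc j"
    by (simp_all only: power_strict_increasing_iff)
  then show "top_diff A B = j" by simp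
qed (use abs_ternary_diff[OF assms] in auto)

text \<open>Two distinct members of \<open>S\<close> differ at their top difference, which lies in
  \<open>J\<close>; so intersecting with \<open>J\<close> is injective on \<open>S\<close>.\<close>

lemma card_le_two_power_top_diffs:
  assumes "finite J" "\<And>A. A \<in> S \<Longrightarrow> finite A"
    and "\<And>A B. A \<in> S \<Longrightarrow> B \<in> S \<Longrightarrow> A \<noteq> B \<Longrightarrow> top_diff A B \<in> J"
  shows "card S \<le> 2 ^ card J"
proof -
  have "inj_on (\<lambda>A. A \<inter> J) S"
  proof (rule inj_onI, rule ccontr)
    fix A B assume AB: "A \<in> S" "B \<in> S" "A \<inter> J = B \<inter> J" "A \<noteq> B"
    then show False
      using top_diff(1)[OF assms(2)[OF AB(1)] assms(2)[OF AB(2)] AB(4)] assms(3)[OF AB(1,2,4)] by blast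
  qed
  then have "card S \<le> card (Pow J)" using assms(1) by (intro card_inj_on_le[of _ S]) auto
  then show ?thesis by (simp add: card_Pow assms(1))
qed

section \<open>Realization by quadratic polynomials\<close>

lemma mvpoly_eval_add:
  fixes g h :: "('x::finite, 'a::comm_semiring_1) mvpoly"
  shows "mvpoly_eval (g + h) f = mvpoly_eval g f + mvpoly_eval h f"
proof -
  define mon where "mon mo = (\<Prod>x \<in> Poly_Mapping.keys mo. f x ^ Poly_Mapping.lookup mo x)" for mo
  define K where "K = Poly_Mapping.keys g \<union> Poly_Mapping.keys h"
  have eq: "mvpoly_eval k f = (\<Sum>mo\<in>K. Poly_Mapping.lookup k mo * mon mo)"
    if "Poly_Mapping.keys k \<subseteq> K" for k :: "('x, 'a) mvpoly"
    unfolding mvpoly_eval_def mon_def[symmetric]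
    using that by (intro sum.mono_neutral_left) (auto simp: K_def in_keys_iff)
  have "Poly_Mapping.keys (g + h) \<subseteq> K" unfolding K_def by (rule keys_add)
  then show ?thesis
    by (simp add: eq K_def lookup_add distrib_right sum.distrib)
qed

lemma mvpoly_eval_single:
  "mvpoly_eval (Poly_Mapping.single mo c) f =
    c * (\<Prod>x\<in>Poly_Mapping.keys mo. f x ^ Poly_Mapping.lookup mo x)"
  by (cases "c = 0") (simp_all add: mvpoly_eval_def)

lemma mvpoly_degree_le_iff:
  "mvpoly_degree g \<le> d \<longleftrightarrow>
    (\<forall>mo\<in>Poly_Mapping.keys g. (\<Sum>x\<in>Poly_Mapping.keys mo. Poly_Mapping.lookup mo x) \<le> d)"
  by (simp add: mvpoly_degree_def)

text \<open>Squaring turns bounds on a distance into polynomial inequalities; both bounds needed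
  below have this form.\<close>

lemma ex_quadratic_mvpoly:
  fixes x y :: "'x::finite" and b c :: real
  assumes "x \<noteq> y"
  shows "\<exists>g. mvpoly_degree g \<le> 2 \<and> (\<forall>f. mvpoly_eval g f = b * (f x - f y)\<^sup>2 + c)"
proof -
  let ?s = "Poly_Mapping.single"
  define mxx where "mxx = ?s x (2::nat)"
  define myy where "myy = ?s y (2::nat)"
  define mxy where "mxy = ?s x (1::nat) + ?s y 1"
  define g where "g = ?s mxx b + ?s myy b + ?s mxy (-2 * b) + ?s 0 c"
  have keys_xy: "Poly_Mapping.keys mxy = {x, y}"
    by (auto simp: mxy_def in_keys_iff lookup_add lookup_single when_def split: if_splits)
  have lookup_xy: "Poly_Mapping.lookup mxy x = 1" "Poly_Mapping.lookup mxy y = 1"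
    using assms by (simp_all add: mxy_def lookup_add lookup_single)
  have "Poly_Mapping.keys g \<subseteq> {mxx, myy, mxy, 0}"
    unfolding g_def by (intro order.trans[OF keys_add] Un_least) (auto split: if_splits)
  moreover have "\<forall>mo\<in>{mxx, myy, mxy, 0}. (\<Sum>z\<in>Poly_Mapping.keys mo. Poly_Mapping.lookup mo z) \<le> 2"
    using assms by (simp add: keys_xy lookup_xy) (simp add: mxx_def myy_def)
  ultimately have "mvpoly_degree g \<le> 2" unfolding mvpoly_degree_le_iff by blast
  moreover have "mvpoly_eval g f = b * (f x - f y)\<^sup>2 + c" for f
  proof -
    have "mvpoly_eval g f = b * f x ^ 2 + b * f y ^ 2 + (-2 * b) * (f x * f y) + c"
      unfolding g_def mvpoly_eval_add mvpoly_eval_single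
      using assms by (simp add: keys_xy lookup_xy) (simp add: mxx_def myy_def)
    then show ?thesis by (simp add: power2_eq_square algebra_simps)
  qed
  ultimately show ?thesis by blast
qed

text \<open>If \<open>p\<close> points use the color set \<open>J\<close>, then
  \<open>p \<le> 2 ^ card J\<close>, so at least \<open>log 2 p\<close> colors occur. Each class is
  cut out by two quadratic inequalities.\<close>

lemma upper_bound_construction:
  assumes "n \<le> 2 ^ m" "t \<ge> 2" "q \<le> nat \<lceil>log 2 (real p)\<rceil>" "p \<ge> 1"
  shows "semialg_ramsey TYPE('d::finite) t n p q \<le> enat m"
proof -
  obtain \<B> where \<B>: "\<B> \<subseteq> Pow {..<m}" "card \<B> = n" "finite \<B>"
    using obtain_subset_with_card_n[of n "Pow {..<m}"] assms(1) by (auto simp: card_Pow)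
  have fin: "finite A" if "A \<in> \<B>" for A using \<B>(1) that finite_subset by auto
  \<comment> \<open>All coordinates are equal, so any one of them determines the distance of the
    integers, in every dimension.\<close>
  define pt :: "nat set \<Rightarrow> real ^ 'd" where "pt A = (\<chi> i. of_int (ternary A))" for A
  have td_less: "top_diff A B < m" if "A \<in> \<B>" "B \<in> \<B>" "A \<noteq> B" for A B
    using top_diff(1)[OF fin[OF that(1)] fin[OF that(2)] that(3)] \<B>(1) that by blast
  have "inj_on pt \<B>"
  proof (rule inj_onI, rule ccontr)
    fix A B assume AB: "A \<in> \<B>" "B \<in> \<B>" "pt A = pt B" "A \<noteq> B"
    then have "ternary A = ternary B" by (simp add: pt_def vec_eq_iff)
    then show False using abs_ternary_diff(1)[OF fin[OF AB(1)] fin[OF AB(2)] AB(4)]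
      by (simp add: not_less)
  qed
  define V where "V = pt ` \<B>"
  have V: "finite V" "card V = n" using \<B> \<open>inj_on pt \<B>\<close> by (auto simp: V_def card_image)
  define E where "E j = {{pt A, pt B} | A B. A \<in> \<B> \<and> B \<in> \<B> \<and> A \<noteq> B \<and> top_diff A B = j}" for j
  have pt_eq: "pt A = pt B \<longleftrightarrow> A = B" if "A \<in> \<B>" "B \<in> \<B>" for A B
    using \<open>inj_on pt \<B>\<close> that by (auto simp: inj_on_def)
  have E_iff: "{pt A, pt B} \<in> E j \<longleftrightarrow> top_diff A B = j" if "A \<in> \<B>" "B \<in> \<B>" "A \<noteq> B" for A B j
    unfolding E_def using that by (auto simp: doubleton_eq_iff pt_eq top_diff_commute)
  have E_sub: "E j \<subseteq> [V]\<^bsup>2\<^esup>" for j by (auto simp: E_def V_def pt_eq)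
  have edge: "\<exists>A B. A \<in> \<B> \<and> B \<in> \<B> \<and> A \<noteq> B \<and> e = {pt A, pt B}" if "e \<in> [V]\<^bsup>2\<^esup>" for e
    using that unfolding V_def nsets_2_eq by blast
  have "(\<Union>j<m. E j) = [V]\<^bsup>2\<^esup>"
  proof
    show "(\<Union>j<m. E j) \<subseteq> [V]\<^bsup>2\<^esup>" using E_sub by blast
    show "[V]\<^bsup>2\<^esup> \<subseteq> (\<Union>j<m. E j)"
    proof
      fix e assume "e \<in> [V]\<^bsup>2\<^esup>"
      then obtain A B where "A \<in> \<B>" "B \<in> \<B>" "A \<noteq> B" "e = {pt A, pt B}" using edge by blast
      then have "e \<in> E (top_diff A B)" "top_diff A B < m" using E_iff td_less by simp_all
      then show "e \<in> (\<Union>j<m. E j)" by blast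
    qed
  qed
  moreover have "disjoint_family_on E {..<m}"
  proof -
    have "i = j" if e: "e \<in> E i" "e \<in> E j" for e i j
    proof -
      obtain A B where "A \<in> \<B>" "B \<in> \<B>" "A \<noteq> B" "e = {pt A, pt B}"
        using edge[OF subsetD[OF E_sub e(1)]] by blast
      then show ?thesis using e E_iff[of A B] by simp
    qed
    then show ?thesis unfolding disjoint_family_on_def by blast
  qed
  moreover have "q \<le> card {k \<in> {..<m}. E k \<inter> [S]\<^bsup>2\<^esup> \<noteq> {}}" if "S \<in> [V]\<^bsup>p\<^esup>" for S
  proof -
    define J where "J = {k \<in> {..<m}. E k \<inter> [S]\<^bsup>2\<^esup> \<noteq> {}}"
    have "S \<subseteq> pt ` \<B>" "card S = p" using that by (auto simp: nsets_def V_def)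
    then obtain \<S> where \<S>: "\<S> \<subseteq> \<B>" "S = pt ` \<S>" by (meson subset_imageE)
    have "card \<S> \<le> 2 ^ card J"
    proof (rule card_le_two_power_top_diffs)
      show "finite J" by (simp add: J_def)
      show "finite A" if "A \<in> \<S>" for A using fin \<S>(1) that by blast
      fix A B assume AB: "A \<in> \<S>" "B \<in> \<S>" "A \<noteq> B"
      then have "A \<in> \<B>" "B \<in> \<B>" using \<S>(1) by blast+
      then have "{pt A, pt B} \<in> E (top_diff A B) \<inter> [S]\<^bsup>2\<^esup>" "top_diff A B < m"
        using AB \<S>(2) by (simp_all add: E_iff pt_eq td_less)
      then show "top_diff A B \<in> J" unfolding J_def by blast
    qed
    moreover have "card \<S> = p"
      using \<open>card S = p\<close> \<S> card_image[OF inj_on_subset[OF \<open>inj_on pt \<B>\<close>]] by metis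
    ultimately have "real p \<le> 2 ^ card J" by (metis of_nat_le_iff of_nat_numeral of_nat_power)
    then have "log 2 (real p) \<le> card J" using assms(4) by (simp add: log_le_iff powr_realpow)
    then show ?thesis using assms(3) unfolding J_def[symmetric] by linarith
  qed
  moreover have "semialg_relation V t (E j)" for j
  proof -
    define i :: 'd where "i = undefined"
    obtain g1 :: "('d + 'd, real) mvpoly" where g1: "mvpoly_degree g1 \<le> 2"
      "\<And>f. mvpoly_eval g1 f = 4 * (f (Inl i) - f (Inr i))\<^sup>2 + - (3 ^ j)\<^sup>2"
      using ex_quadratic_mvpoly[of "Inl i" "Inr i" 4 "- (3 ^ j)\<^sup>2"] by auto
    obtain g2 :: "('d + 'd, real) mvpoly" where g2: "mvpoly_degree g2 \<le> 2"
      "\<And>f. mvpoly_eval g2 f = - 4 * (f (Inl i) - f (Inr i))\<^sup>2 + (3 ^ Suc j)\<^sup>2"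
      using ex_quadratic_mvpoly[of "Inl i" "Inr i" "- 4" "(3 ^ Suc j)\<^sup>2"] by auto
    have sq: "0 \<le> 4 * x\<^sup>2 + - (3 ^ j)\<^sup>2 \<longleftrightarrow> 3 ^ j \<le> 2 * \<bar>x\<bar>"
      "0 \<le> - 4 * x\<^sup>2 + (3 ^ Suc j)\<^sup>2 \<longleftrightarrow> 2 * \<bar>x\<bar> \<le> 3 ^ Suc j" for x :: real
      using abs_le_square_iff[of "3 ^ j" "2 * x"] abs_le_square_iff[of "2 * x" "3 ^ Suc j"]
      by (simp_all add: abs_mult power_mult_distrib del: power_Suc)
    have holds: "semialg_holds (BAnd (BVar 0) (BVar 1)) [g1, g2] u v \<longleftrightarrow>
        3 ^ j \<le> 2 * \<bar>u $ i - v $ i\<bar> \<and> 2 * \<bar>u $ i - v $ i\<bar> \<le> 3 ^ Suc j" for u v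
      by (simp only: semialg_holds_def bool_formula_eval.simps nth_Cons_0 nth_Cons_Suc One_nat_def
          g1 g2 sum.case sq)
    \<comment> \<open>The relations are given by weak inequalities, the colors by strict ones. They
      agree because \<open>3 ^ k\<close> is odd and \<open>2 * \<bar>a - b\<bar>\<close> is
      even.\<close>
    have int_iff: "3 ^ j \<le> 2 * \<bar>real_of_int a - of_int b\<bar> \<and> 2 * \<bar>real_of_int a - of_int b\<bar> \<le> 3 ^ Suc j
        \<longleftrightarrow> 3 ^ j < 2 * \<bar>a - b\<bar> \<and> 2 * \<bar>a - b\<bar> < 3 ^ Suc j" for a b
    proof -
      have "odd ((3::int) ^ k)" for k by simp
      then have "3 ^ k \<noteq> 2 * \<bar>a - b\<bar>" for k by (metis dvd_triv_left)
      moreover have "3 ^ j \<le> 2 * \<bar>real_of_int a - of_int b\<bar> \<longleftrightarrow> 3 ^ j \<le> 2 * \<bar>a - b\<bar>"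
        using of_int_le_iff[of "3 ^ j" "2 * \<bar>a - b\<bar>", where ?'a = real] by simp
      moreover have "2 * \<bar>real_of_int a - of_int b\<bar> \<le> 3 ^ Suc j \<longleftrightarrow> 2 * \<bar>a - b\<bar> \<le> 3 ^ Suc j"
        using of_int_le_iff[of "2 * \<bar>a - b\<bar>" "3 ^ Suc j", where ?'a = real] by simp
      ultimately show ?thesis by (metis order_le_less)
    qed
    have "{u, v} \<in> E j \<longleftrightarrow> semialg_holds (BAnd (BVar 0) (BVar 1)) [g1, g2] u v"
      if uv: "u \<in> V" "v \<in> V" "u \<noteq> v" for u v
    proof -
      obtain A B where AB: "A \<in> \<B>" "B \<in> \<B>" "u = pt A" "v = pt B" using uv by (auto simp: V_def)
      then have "A \<noteq> B" using uv(3) by blast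
      have coord: "pt A $ i = of_int (ternary A)" "pt B $ i = of_int (ternary B)"
        by (simp_all add: pt_def)
      show ?thesis
        unfolding AB(3,4) E_iff[OF AB(1,2) \<open>A \<noteq> B\<close>] holds coord int_iff
        by (rule top_diff_eq_iff[OF fin[OF AB(1)] fin[OF AB(2)] \<open>A \<noteq> B\<close>])
    qed
    moreover have "semialg_holds (BAnd (BVar 0) (BVar 1)) [g1, g2] u v =
        semialg_holds (BAnd (BVar 0) (BVar 1)) [g1, g2] v u" for u v
      unfolding holds by (simp add: abs_minus_commute)
    ultimately show ?thesis
      unfolding semialg_relation_def using E_sub g1(1) g2(1) assms(2)
      by (intro conjI exI[of _ "[g1, g2]"] exI[of _ "BAnd (BVar 0) (BVar 1)"]) auto
  qed
  ultimately have "pq_coloring V p q m E" "\<forall>k<m. semialg_relation V t (E k)"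
    by (auto simp: pq_coloring_def)
  then show ?thesis unfolding semialg_ramsey_def using V by (intro Inf_lower) blast
qed

text \<open>The number of colors is \<open>log 2 n\<close> rounded up; the factor 2 absorbs the
  rounding once \<open>n \<ge> 2\<close>.\<close>

lemma upper_bound:
  assumes "t \<ge> 2" "p \<ge> 1"
  shows "\<forall>\<^sub>F n in sequentially.
    ereal_of_enat (semialg_ramsey TYPE('d::finite) t n p (nat \<lceil>log 2 (real p)\<rceil>))
      \<le> ereal (2 * log 2 (real n))"
  using eventually_ge_at_top[of 2]
proof eventually_elim
  case (elim n)
  define m where "m = nat \<lceil>log 2 (real n)\<rceil>"
  have "log 2 (real n) \<ge> 1" using elim by (simp add: le_log_iff)
  then have m: "log 2 (real n) \<le> real m" "real m \<le> 2 * log 2 (real n)"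
    unfolding m_def by linarith+
  have "real n = 2 powr log 2 (real n)" using elim by simp
  also have "\<dots> \<le> 2 powr real m" using m(1) by simp
  also have "\<dots> = 2 ^ m" by (simp add: powr_realpow)
  finally have "n \<le> 2 ^ m" by (metis of_nat_le_iff of_nat_numeral of_nat_power)
  then have "semialg_ramsey TYPE('d) t n p (nat \<lceil>log 2 (real p)\<rceil>) \<le> enat m"
    using upper_bound_construction[OF _ assms(1) order_refl assms(2)] by blast
  then have "ereal_of_enat (semialg_ramsey TYPE('d) t n p (nat \<lceil>log 2 (real p)\<rceil>)) \<le> ereal_of_enat (enat m)"
    by (simp only: ereal_of_enat_le_iff)
  also have "\<dots> \<le> ereal (2 * log 2 (real n))" using m(2) by simp
  finally show ?case .
qed

theorem theorem1p3:
  fixes t :: nat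
  assumes "t \<ge> 1"
  shows
    "(\<exists>c::real. c > 0 \<and>
        (\<forall>p::nat. p \<ge> 3 \<longrightarrow>
          (\<exists>C::real. C > 0 \<and>
            (\<forall>\<^sub>F n in sequentially.
               ereal_of_enat (semialg_ramsey TYPE('d::finite) t n p (nat \<lceil>log 2 (real p)\<rceil> + 1))
                 \<ge> ereal (C * real n powr (1 / (c * (log 2 (real p))\<^sup>2))))))) \<and>
     (t \<ge> 4 \<longrightarrow>
        (\<forall>p::nat. p \<ge> 3 \<longrightarrow>
          (\<exists>C::real. C > 0 \<and>
            (\<forall>\<^sub>F n in sequentially.
               ereal_of_enat (semialg_ramsey TYPE('d) t n p (nat \<lceil>log 2 (real p)\<rceil>))
                 \<le> ereal (C * log 2 (real n))))))"
proof (intro conjI impI)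
  obtain c :: real where "c > 0" and c: "\<And>p::nat. p \<ge> 3 \<Longrightarrow> \<forall>\<^sub>F n in sequentially.
      ereal_of_enat (semialg_ramsey TYPE('d) t n p (nat \<lceil>log 2 (real p)\<rceil> + 1))
        \<ge> ereal (real n powr (1 / (c * (log 2 (real p))\<^sup>2)))"
    using lower_bound[OF assms, where 'd = 'd] by blast
  show "\<exists>c::real. c > 0 \<and> (\<forall>p::nat. p \<ge> 3 \<longrightarrow> (\<exists>C::real. C > 0 \<and> (\<forall>\<^sub>F n in sequentially.
      ereal_of_enat (semialg_ramsey TYPE('d) t n p (nat \<lceil>log 2 (real p)\<rceil> + 1))
        \<ge> ereal (C * real n powr (1 / (c * (log 2 (real p))\<^sup>2))))))"
  \<comment> \<open>The implied constant is 1; dependence on \<open>p\<close> remains only in how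
    large \<open>n\<close> must be and in the exponent.\<close>
  proof (rule exI[of _ c], intro exI[of _ 1] conjI allI impI)
    fix p :: nat assume "p \<ge> 3"
    then show "\<forall>\<^sub>F n in sequentially.
        ereal_of_enat (semialg_ramsey TYPE('d) t n p (nat \<lceil>log 2 (real p)\<rceil> + 1))
          \<ge> ereal (1 * real n powr (1 / (c * (log 2 (real p))\<^sup>2)))"
      using c by simp
  qed (use \<open>c > 0\<close> in simp_all)
next
  assume "t \<ge> 4"
  show "\<forall>p::nat. p \<ge> 3 \<longrightarrow> (\<exists>C::real. C > 0 \<and> (\<forall>\<^sub>F n in sequentially.
      ereal_of_enat (semialg_ramsey TYPE('d) t n p (nat \<lceil>log 2 (real p)\<rceil>))
        \<le> ereal (C * log 2 (real n))))"
  proof (intro allI impI exI[of _ 2] conjI)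
    fix p :: nat assume "p \<ge> 3"
    then show "\<forall>\<^sub>F n in sequentially.
        ereal_of_enat (semialg_ramsey TYPE('d) t n p (nat \<lceil>log 2 (real p)\<rceil>))
          \<le> ereal (2 * log 2 (real n))"
      using \<open>t \<ge> 4\<close> by (intro upper_bound) auto
  qed simp
qed

end
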